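(* Let $f=\frac1N\sum_{i=1}^N f_i$ be uniformly convex of degree $q\ge2$ with constant $\sigma_q>0$ and admit a stochastic $p\ge1$ higher-order surrogate function $g$ over $\mathcal X$ with $L_p^{h_j}=L_p^h$ for all $j$. Let $x^*$ be the unique minimizer of $f$ over $\mathcal X$, and let $(x_k)$, $\hat x_k=(x_k^1,\dots,x_k^N)$ be generated by SHOM with minibatch size $\tau$, each $x_{k+1}$ being a global minimizer of $\min_{y\in\mathcal X}g(y;\hat x_k)$. Put $$\Phi_k=\frac1N\sum_{j=1}^N\left(f(x_k^j)-f(x^* )\right)^{\frac{p+1}{q}} .$$ Then for all $k\ge0$ $$\mathbb E\left[\Phi_{k+1}\mid S_0,\dots,S_k\right]\le\left[1-\frac\tau N+\frac\tau N\left(\frac{q^{\frac{p+1}{q}}L_p^h}{\sigma_q^{\frac{p+1}{q}}(p+1)!}\right)^{\frac{p+1}{q}}\Phi_k^{\frac{p+1-q}{q}}\right]\Phi_k .$$ Furthermore, let $\alpha\in(0,1)$ and $C=\frac{L_p^h}{(p+1)!}\left(\frac{q}{\sigma_q}\right)^{\frac{p+1}{q}}$. If $q<p+1$ and $f(x_0)-f(x^* )\le\dfrac{\alpha^{\frac{q^2}{(p+1)^2-q(p+1)}}}{C^{\frac{q}{p+1-q}}}$, then for all $k\ge 0$ $$\mathbb E\left[\Phi_{k+1}\mid S_0,\dots,S_k\right]\le\left(1-\frac{(1-\alpha)\tau}{N}\right)\Phi_k .$$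
   Context: Setting. $E$ is a finite-dimensional real vector space with dual $E^*$; $B=B^*\succ0$, $B:E\to E^*$, defines the norm $\|x\|=\langle Bx,x\rangle^{1/2}$ on $E$. The norm of a symmetric $p$-multilinear form $D^p\psi(x)$ is $\max_{\|h\|\le1}|D^p\psi(x)[h]^p|$. A $p$ times continuously differentiable $\psi$ has Lipschitz continuous $p$ derivative with constant $L_p^\psi$ if $\|D^p\psi(x)-D^p\psi(y)\|\le L_p^\psi\|x-y\|$ for all $x,y$ in its domain. Problem: $\min_{x\in\mathcal X} f(x)=\frac1N\sum_{i=1}^N f_i(x)$, where $f_i:\operatorname{dom} f\to\mathbb R$ are lower semicontinuous, $\operatorname{dom} f\subseteq E$ is open, and $\mathcal X\subseteq\operatorname{dom} f$ is closed and convex. Uniform convexity of degree $q\ge2$ with constant $\sigma_q>0$: $f(y)\ge f(x)+\langle f_x,y-x\rangle+\frac{\sigma_q}{q}\|x-y\|^q$ for all $x,y\in\operatorname{dom} f$ and every subgradient $f_x\in\partial f(x)$. Stochastic $p$ higher-order surrogate over $\mathcal X$: for every $\hat x=(x_1,\dots,x_N)\in\mathcal X^N$ there is $g(y;\hat x)=\frac1N\sum_{i=1}^N g_i(y;x_i)$, with $g_i(\cdot;x_i)$ real-valued on a domain containing $\mathcal X$, such that for all $i$: (i) $g_i(y;x_i)\ge f_i(y)$ for all $y\in\mathcal X$; (ii) the error function $h_i(y;x_i)=g_i(y;x_i)-f_i(y)$, with domain $E$, is $p$ times continuously differentiable with Lipschitz continuous $p$ derivative with constant $L_p^{h_i}$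 (not depending on $x_i$); (iii) $\nabla^j h_i(x_i;x_i)=0$ for $j=0,\dots,p$ ($j=0$ meaning $h_i(x_i;x_i)=0$). SHOM algorithm: given an integer $\tau\in[1,N]$, $p\ge1$ and $x_0\in\mathcal X$, set $x_0^j=x_0$ for all $j=1,\dots,N$ (equivalently $x_{-1}^j=x_0$). For $k\ge0$: choose uniformly at random (independently of the past) a subset $S_k\subseteq\{1,\dots,N\}$ of size $\tau$; set $x_k^j=x_k$ if $j\in S_k$ and $x_k^j=x_{k-1}^j$ if $j\notin S_k$; put $\hat x_k=(x_k^1,\dots,x_k^N)$; compute $x_{k+1}$ as a solution of $\min_{y\in\mathcal X} g(y;\hat x_k)$. *)

theory Defs
  imports "HOL-Probability.Probability"
begin

text \<open>
  The space \<open>E\<close> with the norm induced by \<open>B\<close> is a type of class \<open>euclidean_space\<close>: the inner product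
  \<open>x \<bullet> y\<close> is the pairing of \<open>B x\<close> with \<open>y\<close>, and a functional in the dual is represented by its
  Riesz vector \<open>v\<close>, acting as \<open>y \<mapsto> v \<bullet> y\<close>.
\<close>

section \<open>Higher derivatives\<close>

text \<open>
  \<open>hderiv \<psi> [u\<^sub>1, \<dots>, u\<^sub>j] x\<close> is the value \<open>D\<^sup>j\<psi>(x)[u\<^sub>1, \<dots>, u\<^sub>j]\<close> of the \<open>j\<close>-linear derivative form; it is only
  meaningful where the derivatives exist, which \<open>cont_diff\<close> guarantees.
\<close>

primrec hderiv :: "('a::real_normed_vector \<Rightarrow> real) \<Rightarrow> 'a list \<Rightarrow> 'a \<Rightarrow> real" where
  "hderiv \<psi> [] = \<psi>"
| "hderiv \<psi> (u # us) = (\<lambda>x. frechet_derivative (hderiv \<psi> us) (at x) u)"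

text \<open>
  \<open>p\<close> times continuous differentiability on the whole space. In finite dimension, differentiability or
  continuity of the form-valued map \<open>D\<^sup>j\<psi>\<close> is differentiability or continuity of all its evaluations.
\<close>

definition cont_diff :: "nat \<Rightarrow> ('a::real_normed_vector \<Rightarrow> real) \<Rightarrow> bool" where
  "cont_diff p \<psi> \<longleftrightarrow>
     (\<forall>us x. length us < p \<longrightarrow> hderiv \<psi> us differentiable (at x)) \<and>
     (\<forall>us. length us \<le> p \<longrightarrow> continuous_on UNIV (hderiv \<psi> us))"

definition form_norm :: "nat \<Rightarrow> ('a::real_normed_vector list \<Rightarrow> real) \<Rightarrow> real" where
  "form_norm p A = (SUP u\<in>cball 0 1. \<bar>A (replicate p u)\<bar>)"

definition lipschitz_deriv :: "nat \<Rightarrow> real \<Rightarrow> ('a::real_normed_vector \<Rightarrow> real) \<Rightarrow> bool" where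
  "lipschitz_deriv p L \<psi> \<longleftrightarrow> cont_diff p \<psi> \<and>
     (\<forall>x y. form_norm p (\<lambda>us. hderiv \<psi> us x - hderiv \<psi> us y) \<le> L * norm (x - y))"

section \<open>Uniform convexity\<close>

definition lsc_on :: "'a::topological_space set \<Rightarrow> ('a \<Rightarrow> real) \<Rightarrow> bool" where
  "lsc_on D f \<longleftrightarrow> (\<forall>x\<in>D. \<forall>c<f x. \<forall>\<^sub>F y in at x within D. c < f y)"

text \<open>
  Convexity of \<open>f\<close> is not a separate hypothesis, so the subdifferential is the one for general lower
  semicontinuous functions (regular, or Frechet, subgradients). With global affine minorants
  instead, a nowhere convex \<open>f\<close> would have no subgradients and be vacuously uniformly convex.
  For convex \<open>f\<close> the two notions agree, see \<open>subdifferential_convex\<close> below.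
\<close>

definition subdifferential :: "'a::euclidean_space set \<Rightarrow> ('a \<Rightarrow> real) \<Rightarrow> 'a \<Rightarrow> 'a set" where
  "subdifferential D f x =
     {v. \<forall>e>0. \<forall>\<^sub>F y in at x within D. f y \<ge> f x + v \<bullet> (y - x) - e * norm (y - x)}"

definition unif_convex_on :: "'a::euclidean_space set \<Rightarrow> real \<Rightarrow> real \<Rightarrow> ('a \<Rightarrow> real) \<Rightarrow> bool" where
  "unif_convex_on D q \<sigma> f \<longleftrightarrow>
     (\<forall>x\<in>D. \<forall>y\<in>D. \<forall>v\<in>subdifferential D f x.
        f y \<ge> f x + v \<bullet> (y - x) + \<sigma> / q * norm (x - y) powr q)"

lemma subdifferential_convex:
  fixes f :: "'a::euclidean_space \<Rightarrow> real"
  assumes f: "convex_on D f" and x: "x \<in> D"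
  shows "subdifferential D f x = {v. \<forall>y\<in>D. f y \<ge> f x + v \<bullet> (y - x)}"
proof (intro equalityI subsetI CollectI ballI)
  fix v y assume v: "v \<in> subdifferential D f x" and y: "y \<in> D"
  have D: "convex D" using f by (rule convex_on_imp_convex)
  show "f y \<ge> f x + v \<bullet> (y - x)"
  proof (cases "y = x")
    case False
    let ?z = "\<lambda>t. x + t *\<^sub>R (y - x)"
    have z: "?z t = (1 - t) *\<^sub>R x + t *\<^sub>R y" for t
      by (simp add: algebra_simps)
    have bound: "f x + v \<bullet> (y - x) \<le> f y + e * norm (y - x)" if e: "e > 0" for e
    proof -
      have ev: "\<forall>\<^sub>F u in at x within D. f u \<ge> f x + v \<bullet> (u - x) - e * norm (u - x)"
        using v e by (auto simp: subdifferential_def)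
      have lim: "filterlim ?z (at x within D) (at_right 0)"
        unfolding filterlim_at
      proof
        have "isCont ?z 0" by (intro continuous_intros)
        then show "(?z \<longlongrightarrow> x) (at_right 0)"
          using filterlim_at_split[of ?z "nhds x" 0] by (simp add: isCont_def)
        show "\<forall>\<^sub>F t in at_right 0. ?z t \<in> D \<and> ?z t \<noteq> x"
          unfolding eventually_at_right_field
        proof (intro exI[of _ 1] conjI allI impI)
          fix t :: real assume "0 < t" "t < 1"
          then show "?z t \<in> D"
            unfolding z by (intro convexD[OF D x y]) auto
        qed (use False in auto)
      qed
      have "\<forall>\<^sub>F t in at_right 0. f (?z t) \<ge> f x + v \<bullet> (?z t - x) - e * norm (?z t - x)"
        using ev lim by (rule eventually_compose_filterlim)
      then obtain b where b: "b > 0"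
        "\<And>t. 0 < t \<Longrightarrow> t < b \<Longrightarrow> f (?z t) \<ge> f x + v \<bullet> (?z t - x) - e * norm (?z t - x)"
        unfolding eventually_at_right_field by auto
      define t where "t = min (b / 2) (1 / 2)"
      have t: "0 < t" "t < b" "t < 1" using b(1) by (auto simp: t_def)
      have "f (?z t) \<le> (1 - t) * f x + t * f y"
        unfolding z by (intro convex_onD[OF f]) (use t x y in auto)
      moreover have "f (?z t) \<ge> f x + t * (v \<bullet> (y - x)) - e * (t * norm (y - x))"
        using b(2)[OF t(1,2)] t(1) by simp
      ultimately have "t * (f x + v \<bullet> (y - x)) \<le> t * (f y + e * norm (y - x))"
        by (simp add: ring_distribs mult.left_commute)
      then show ?thesis using t by simp
    qed
    show ?thesis
    proof (rule field_le_epsilon)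
      fix e :: real assume "e > 0"
      with bound[of "e / norm (y - x)"] False show "f x + v \<bullet> (y - x) \<le> f y + e" by simp
    qed
  qed simp
next
  fix v assume "v \<in> {v. \<forall>y\<in>D. f y \<ge> f x + v \<bullet> (y - x)}"
  then have *: "f y \<ge> f x + v \<bullet> (y - x)" if "y \<in> D" for y using that by blast
  have "\<forall>\<^sub>F y in at x within D. f y \<ge> f x + v \<bullet> (y - x) - e * norm (y - x)" if "e > 0" for e
    unfolding eventually_at_filter
    by (intro always_eventually allI impI) (smt (verit) * mult_nonneg_nonneg norm_ge_zero that)
  then show "v \<in> subdifferential D f x" by (simp add: subdifferential_def)
qed

section \<open>Surrogates and the algorithm\<close>

definition avg :: "nat \<Rightarrow> (nat \<Rightarrow> real) \<Rightarrow> real" where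
  "avg N a = (\<Sum>i=1..N. a i) / real N"

text \<open>
  \<open>g i y x\<close> stands for \<open>g\<^sub>i(y; x)\<close>. The error function has domain \<open>E\<close>, whereas \<open>g\<^sub>i(\<cdot>; x) - f\<^sub>i\<close> is only known
  to make sense on \<open>X\<close>; hence it is a function \<open>h\<close> on \<open>E\<close> that coincides with the difference on \<open>X\<close>.
\<close>

definition surrogate ::
    "'a::euclidean_space set \<Rightarrow> nat \<Rightarrow> nat \<Rightarrow> real \<Rightarrow> (nat \<Rightarrow> 'a \<Rightarrow> real) \<Rightarrow> (nat \<Rightarrow> 'a \<Rightarrow> 'a \<Rightarrow> real) \<Rightarrow> bool"
  where
  "surrogate X N p L f g \<longleftrightarrow>
     (\<forall>i\<in>{1..N}. \<forall>x\<in>X.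
        (\<forall>y\<in>X. g i y x \<ge> f i y) \<and>
        (\<exists>h. (\<forall>y\<in>X. h y = g i y x - f i y) \<and>
             lipschitz_deriv p L h \<and>
             (\<forall>us. length us \<le> p \<longrightarrow> hderiv h us x = 0)))"

definition minibatches :: "nat \<Rightarrow> nat \<Rightarrow> nat set set" where
  "minibatches N \<tau> = {T. T \<subseteq> {1..N} \<and> card T = \<tau>}"

text \<open>
  \<open>anchor S x k j\<close> is \<open>x\<^sub>k\<^sup>j\<close>. At \<open>k = 0\<close> both cases of the update give \<open>x\<^sub>0\<close>.
\<close>

primrec anchor :: "(nat \<Rightarrow> nat set) \<Rightarrow> (nat \<Rightarrow> 'a) \<Rightarrow> nat \<Rightarrow> nat \<Rightarrow> 'a" where
  "anchor S x 0 j = x 0"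
| "anchor S x (Suc k) j = (if j \<in> S (Suc k) then x (Suc k) else anchor S x k j)"

definition SHOM_run ::
    "'a set \<Rightarrow> nat \<Rightarrow> (nat \<Rightarrow> 'a \<Rightarrow> 'a \<Rightarrow> real) \<Rightarrow> 'a \<Rightarrow> (nat \<Rightarrow> nat set) \<Rightarrow> (nat \<Rightarrow> 'a) \<Rightarrow> bool" where
  "SHOM_run X N g x0 S x \<longleftrightarrow> x 0 = x0 \<and>
     (\<forall>k. is_arg_min (\<lambda>y. avg N (\<lambda>i. g i y (anchor S x k i))) (\<lambda>y. y \<in> X) (x (Suc k)))"

text \<open>The sigma-algebra generated by \<open>S\<^sub>0, \<dots>, S\<^sub>k\<close>.\<close>

definition history :: "'w measure \<Rightarrow> (nat \<Rightarrow> 'w \<Rightarrow> nat set) \<Rightarrow> nat \<Rightarrow> 'w measure" where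
  "history M S k = sigma (space M) {S i -` A \<inter> space M | i A. i \<le> k}"

text \<open>
  Measurability of \<open>x (Suc k)\<close> with respect to \<open>history M S k\<close> expresses that the minimizer is picked
  as a function of the minibatches drawn so far, with no further randomness; together with the
  mutual independence of the \<open>S k\<close> this makes each \<open>S k\<close> independent of the past of the algorithm.
\<close>

definition SHOM ::
    "'w measure \<Rightarrow> 'a::euclidean_space set \<Rightarrow> nat \<Rightarrow> nat \<Rightarrow> (nat \<Rightarrow> 'a \<Rightarrow> 'a \<Rightarrow> real) \<Rightarrow> 'a \<Rightarrow>
      (nat \<Rightarrow> 'w \<Rightarrow> nat set) \<Rightarrow> (nat \<Rightarrow> 'w \<Rightarrow> 'a) \<Rightarrow> bool" where
  "SHOM M X N \<tau> g x0 S x \<longleftrightarrow>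
     prob_space M \<and>
     prob_space.indep_vars M (\<lambda>_. count_space (minibatches N \<tau>)) S UNIV \<and>
     (\<forall>k. distr M (count_space (minibatches N \<tau>)) (S k) = uniform_count_measure (minibatches N \<tau>)) \<and>
     (\<forall>k. x (Suc k) \<in> borel_measurable (history M S k)) \<and>
     (\<forall>\<omega>\<in>space M. SHOM_run X N g x0 (\<lambda>k. S k \<omega>) (\<lambda>k. x k \<omega>))"

text \<open>The Lyapunov function, along one realization of the algorithm.\<close>

definition Lyap ::
    "nat \<Rightarrow> nat \<Rightarrow> real \<Rightarrow> ('a \<Rightarrow> real) \<Rightarrow> 'a \<Rightarrow> (nat \<Rightarrow> nat set) \<Rightarrow> (nat \<Rightarrow> 'a) \<Rightarrow> nat \<Rightarrow> real" where
  "Lyap N p q F xstar S x k =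
     avg N (\<lambda>j. (F (anchor S x k j) - F xstar) powr ((real p + 1) / q))"

end

theory Submission
  imports Defs
begin

text \<open>
  Write \<open>r = (p + 1) / q\<close>, \<open>F\<close> for the objective and \<open>\<delta> y = F y - F x\<^sup>*\<close>. Majorization, the optimality of
  \<open>x\<^bsub>k+1\<^esub>\<close> and a Taylor bound for the error functions give
  \<open>\<delta> x\<^bsub>k+1\<^esub> \<le> L / (p+1)! \<cdot> avg\<^sub>j \<parallel>x\<^sup>* - x\<^sub>k\<^sup>j\<parallel>\<^bsup>p+1\<^esup>\<close>, and the growth \<open>\<delta> y \<ge> \<sigma>/q \<parallel>y - x\<^sup>*\<parallel>\<^bsup>q\<^esup>\<close> on \<open>X\<close>
  turns this into \<open>\<delta> x\<^bsub>k+1\<^esub> \<le> C \<Phi>\<^sub>k\<close>. Each anchor is replaced by \<open>x\<^bsub>k+1\<^esub>\<close> with probability \<open>\<tau>/N\<close>,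
  independently of the history, so the conditional expectation of \<open>\<Phi>\<^bsub>k+1\<^esub>\<close> is
  \<open>(1 - \<tau>/N) \<Phi>\<^sub>k + \<tau>/N (\<delta> x\<^bsub>k+1\<^esub>)\<^bsup>r\<^esup>\<close>. Under the initial condition all anchors keep \<open>\<delta> \<le> \<delta> x\<^sub>0\<close>,
  hence \<open>C\<^bsup>r\<^esup> \<Phi>\<^sub>k\<^bsup>r-1\<^esup> \<le> \<alpha>\<close> for all \<open>k\<close>.

  The growth bound needs true subgradients, although \<open>F\<close> is only lower semicontinuous and \<open>D\<close> need not
  be convex. Regular subgradients exist at a dense set of points; uniform convexity makes
  them slopes of affine minorants, which are bounded near a point of the open set \<open>D\<close>, so that a limit
  of them satisfies the uniform convexity inequality at every point of \<open>D\<close>.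
\<close>

section \<open>Lower semicontinuity\<close>

text \<open>Openness of \<open>D\<close> turns the relative neighbourhoods of \<open>lsc_on\<close>
  into neighbourhoods in the whole space. Compactness, sequences and measurability all use lower
  semicontinuity in this form.\<close>

lemma lsc_on_superlevel_open:
  assumes "open D" and lsc: "lsc_on D f"
  shows "open {y \<in> D. c < f y}"
  unfolding open_subopen[of "{y \<in> D. c < f y}"]
proof
  fix x assume "x \<in> {y \<in> D. c < f y}"
  then have x: "x \<in> D" "c < f x" by auto
  then have "\<forall>\<^sub>F y in at x. c < f y"
    using lsc at_within_open[OF x(1) assms(1)] by (auto simp: lsc_on_def)
  then obtain U where U: "open U" "x \<in> U" "\<And>y. y \<in> U \<Longrightarrow> y \<noteq> x \<Longrightarrow> c < f y"
    unfolding eventually_at_topological by blast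
  show "\<exists>T. open T \<and> x \<in> T \<and> T \<subseteq> {y \<in> D. c < f y}"
    by (rule exI[of _ "U \<inter> D"]) (use U x assms(1) in \<open>auto intro: open_Int\<close>)
qed

lemma lsc_on_add:
  assumes "lsc_on D f" "lsc_on D g"
  shows "lsc_on D (\<lambda>x. f x + g x)"
  unfolding lsc_on_def
proof (intro ballI allI impI)
  fix x c assume x: "x \<in> D" and c: "c < f x + g x"
  define e where "e = (f x + g x - c) / 2"
  have "\<forall>\<^sub>F y in at x within D. f x - e < f y" "\<forall>\<^sub>F y in at x within D. g x - e < g y"
    using assms x c by (auto simp: lsc_on_def e_def)
  then show "\<forall>\<^sub>F y in at x within D. c < f y + g y"
    by eventually_elim (simp add: e_def field_simps)
qed

lemma lsc_on_continuous:
  assumes "continuous_on D f"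
  shows "lsc_on D f"
  using assms unfolding lsc_on_def continuous_on_def by (auto intro: order_tendstoD)

lemma lsc_on_sum:
  assumes "finite I" "\<And>i. i \<in> I \<Longrightarrow> lsc_on D (f i)"
  shows "lsc_on D (\<lambda>x. \<Sum>i\<in>I. f i x)"
  using assms
proof (induction I rule: finite_induct)
  case (insert i I)
  have "lsc_on D (\<lambda>x. f i x + (\<Sum>i\<in>I. f i x))"
    using insert by (intro lsc_on_add) auto
  then show ?case using insert by simp
qed (simp add: lsc_on_continuous)

lemma lsc_on_divide:
  assumes "lsc_on D f" "(c::real) > 0"
  shows "lsc_on D (\<lambda>x. f x / c)"
  using assms unfolding lsc_on_def by (simp add: pos_less_divide_eq)

lemma lsc_on_avg:
  assumes "\<And>i. i \<in> {1..N} \<Longrightarrow> lsc_on D (f i)" "N > 0"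
  shows "lsc_on D (\<lambda>y. avg N (\<lambda>i. f i y))"
  unfolding avg_def using assms by (intro lsc_on_divide lsc_on_sum) auto

text \<open>Without a minimizer every point of \<open>K\<close> lies in an open set
  \<open>{u \<in> D. f y < f u}\<close> with \<open>y \<in> K\<close>. Among the finitely many
  centres of a subcover, the one with least value cannot be covered.\<close>

lemma lsc_on_attains_inf:
  assumes "open D" and lsc: "lsc_on D f" and K: "compact K" "K \<noteq> {}" "K \<subseteq> D"
  obtains x where "x \<in> K" "\<And>y. y \<in> K \<Longrightarrow> f x \<le> f y"
proof (rule ccontr)
  assume "\<not> thesis"
  with that have "\<forall>x\<in>K. \<exists>y\<in>K. f y < f x" by force
  then have cover: "K \<subseteq> (\<Union>y\<in>K. {u \<in> D. f y < f u})" using K(3) by blast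
  obtain T where T: "T \<subseteq> K" "finite T" "K \<subseteq> (\<Union>y\<in>T. {u \<in> D. f y < f u})"
    by (rule compactE_image[OF K(1) lsc_on_superlevel_open[OF assms(1) lsc] cover])
  have "T \<noteq> {}" using T(3) K(2) by auto
  then obtain y where y: "y \<in> T" "\<And>z. z \<in> T \<Longrightarrow> f y \<le> f z"
    using arg_min_if_finite(1)[OF T(2)] arg_min_least[OF T(2)] by blast
  then obtain z where "z \<in> T" "f z < f y" using T by blast
  with y show False by fastforce
qed

lemma lsc_on_sequentially:
  assumes "open D" "lsc_on D f" "X \<longlonglongrightarrow> z" "z \<in> D" "c < f z"
  shows "\<forall>\<^sub>F n in sequentially. c < f (X n)"
proof -
  have "\<forall>\<^sub>F n in sequentially. X n \<in> {y \<in> D. c < f y}"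
    using topological_tendstoD[OF assms(3) lsc_on_superlevel_open[OF assms(1,2), of c]] assms(4,5) by simp
  then show ?thesis by eventually_elim simp
qed

text \<open>Outside \<open>D\<close> nothing is known about \<open>f\<close>, so a cut-off version
  is measured; it makes the gaps of the random iterates measurable.\<close>

lemma lsc_on_borel_measurable:
  fixes f :: "'a::euclidean_space \<Rightarrow> real"
  assumes "open D" "lsc_on D f"
  shows "(\<lambda>y. if y \<in> D then f y else 0) \<in> borel_measurable borel"
  unfolding borel_measurable_iff_greater
proof
  fix c
  have "{w. c < (if w \<in> D then f w else 0)} = {y \<in> D. c < f y} \<union> (if c < 0 then - D else {})"
    by auto
  also have "\<dots> \<in> sets borel"
    using lsc_on_superlevel_open[OF assms, of c] assms(1) by auto
  finally show "{w \<in> space borel. c < (if w \<in> D then f w else 0)} \<in> sets borel" by simp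
qed

section \<open>Subgradients of uniformly convex functions\<close>

text \<open>Minimizing \<open>F + n \<parallel>\<cdot> - z\<parallel>\<^sup>2\<close> near \<open>z\<close> yields regular subgradients at points close to \<open>z\<close>.\<close>

lemma subdifferential_dense:
  fixes F :: "'a::euclidean_space \<Rightarrow> real"
  assumes D: "open D" and lsc: "lsc_on D F" and z: "z \<in> D"
  obtains X V where "X \<longlonglongrightarrow> z" "\<And>n. X n \<in> D" "\<And>n. V n \<in> subdifferential D F (X n)"
proof -
  obtain r where r: "r > 0" "cball z r \<subseteq> D" using D z open_contains_cball by blast
  have ne: "cball z r \<noteq> {}" using r(1) by simp
  obtain w where w: "w \<in> cball z r" "\<And>y. y \<in> cball z r \<Longrightarrow> F w \<le> F y"
    using lsc_on_attains_inf[OF D lsc compact_cball ne r(2)] by blast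
  have "\<exists>x. dist x z < e \<and> x \<in> D \<and> (\<exists>v. v \<in> subdifferential D F x)" if e: "e > 0" for e
  proof -
    define d where "d = min e r / 2"
    have d: "0 < d" "d < e" "d < r" using e r by (auto simp: d_def)
    \<comment> \<open>At distance \<open>d\<close> the penalty costs \<open>F z - F w + 1\<close>,
      more than the largest possible decrease \<open>F z - F w\<close> on the ball, so the minimizer
      of \<open>G\<close> lies within \<open>d\<close> of \<open>z\<close>. As \<open>d < r\<close>,
      it is interior to the ball.\<close>
    define n where "n = (F z - F w + 1) / d\<^sup>2"
    have Fzw: "F w \<le> F z" using w r by auto
    have n: "n > 0" using Fzw d by (auto simp: n_def)
    define G where "G y = F y + n * (norm (y - z))\<^sup>2" for y
    have "lsc_on D G"
      unfolding G_def by (intro lsc_on_add lsc lsc_on_continuous continuous_intros)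
    then obtain x where x: "x \<in> cball z r" "\<And>y. y \<in> cball z r \<Longrightarrow> G x \<le> G y"
      using lsc_on_attains_inf[OF D _ compact_cball ne r(2)] by blast
    have "n * (norm (x - z))\<^sup>2 \<le> F z - F w"
      using x(2)[of z] w(2)[OF x(1)] r(1) by (simp add: G_def)
    also have "\<dots> < n * d\<^sup>2" using d by (simp add: n_def)
    finally have "norm (x - z) < d" using n d by (simp add: power_less_imp_less_base)
    then have xz: "dist x z < d" by (simp add: dist_norm)
    have xball: "x \<in> ball z r" using xz d by (simp add: dist_commute)
    \<comment> \<open>Minus the gradient of the penalty at \<open>x\<close>. Minimality gives an
      affine lower bound of slope \<open>v\<close> with error
      \<open>n * (norm (y - x))\<^sup>2\<close>, which is at most \<open>e' * norm (y - x)\<close>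
      within distance \<open>e' / n\<close> of \<open>x\<close>.\<close>
    define v where "v = (- 2 * n) *\<^sub>R (x - z)"
    have key: "F x + v \<bullet> (y - x) - n * (norm (y - x))\<^sup>2 \<le> F y" if "y \<in> cball z r" for y
    proof -
      have "F y \<ge> F x + n * ((norm (x - z))\<^sup>2 - (norm (y - z))\<^sup>2)"
        using x(2)[OF that] by (simp add: G_def algebra_simps)
      moreover have "n * ((norm (x - z))\<^sup>2 - (norm (y - z))\<^sup>2) = v \<bullet> (y - x) - n * (norm (y - x))\<^sup>2"
        unfolding v_def power2_norm_eq_inner by (simp add: algebra_simps inner_commute)
      ultimately show ?thesis by simp
    qed
    have "v \<in> subdifferential D F x"
      unfolding subdifferential_def
    proof (intro CollectI allI impI)
      fix e' :: real assume e': "e' > 0"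
      have "\<forall>\<^sub>F y in nhds x. y \<in> ball z r \<inter> ball x (e' / n)"
        by (rule eventually_nhds_in_open) (use xball e' n in auto)
      then have "\<forall>\<^sub>F y in nhds x. F x + v \<bullet> (y - x) - e' * norm (y - x) \<le> F y"
      proof eventually_elim
        case (elim y)
        have "n * norm (y - x) \<le> e'"
          using elim n by (simp add: dist_norm norm_minus_commute field_simps)
        then have "n * (norm (y - x))\<^sup>2 \<le> e' * norm (y - x)"
          using mult_right_mono[of "n * norm (y - x)" e' "norm (y - x)"] by (simp add: power2_eq_square mult.assoc)
        then show ?case using key[of y] elim by auto
      qed
      then show "\<forall>\<^sub>F y in at x within D. F x + v \<bullet> (y - x) - e' * norm (y - x) \<le> F y"
        unfolding eventually_at_filter by eventually_elim simp
    qed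
    then show ?thesis using xz d x(1) r(2) by (intro exI[of _ x]) auto
  qed
  then have "\<exists>x. dist x z < inverse (real (Suc n)) \<and> x \<in> D \<and> (\<exists>v. v \<in> subdifferential D F x)" for n
    by simp
  then obtain X V where XV: "\<And>n. dist (X n) z < inverse (real (Suc n))" "\<And>n. X n \<in> D"
    "\<And>n. V n \<in> subdifferential D F (X n)" by metis
  have "X \<longlonglongrightarrow> z"
    unfolding tendsto_dist_iff[of X]
    by (rule tendsto_sandwich[OF _ _ tendsto_const LIMSEQ_inverse_real_of_nat])
       (use XV(1) in \<open>auto intro!: always_eventually less_imp_le simp del: of_nat_Suc\<close>)
  with XV show ?thesis using that by blast
qed

text \<open>Testing the affine minorants at the finitely many points
  \<open>z + r *\<^sub>R b\<close> and \<open>z - r *\<^sub>R b\<close> bounds every coordinate of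
  \<open>V n\<close>. The maximum of \<open>F\<close> over this finite set replaces a local upper
  bound, which lower semicontinuity does not supply.\<close>

lemma bounded_slopes:
  fixes V :: "nat \<Rightarrow> 'a::euclidean_space"
  assumes D: "open D" and z: "z \<in> D" and X: "X \<longlonglongrightarrow> z"
    and aff: "\<And>n y. y \<in> D \<Longrightarrow> c + V n \<bullet> (y - X n) \<le> F y"
  obtains B where "\<forall>\<^sub>F n in sequentially. norm (V n) \<le> B"
proof -
  obtain r where r: "r > 0" "cball z r \<subseteq> D" using D z open_contains_cball by blast
  define P where "P = (\<lambda>b. z + r *\<^sub>R b) ` (Basis \<union> uminus ` Basis)"
  have P: "finite P" "P \<noteq> {}" "P \<subseteq> D"
    using r by (auto simp: P_def dist_norm subset_iff)
  define m where "m = Max (F ` P) - c"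
  have m: "F y - c \<le> m" if "y \<in> P" for y using P that by (simp add: m_def)
  \<comment> \<open>Replacing \<open>X n\<close> by \<open>z\<close> costs at most
    \<open>norm (V n) * d\<close> per coordinate. Summed over the basis this is
    \<open>r / 2 * norm (V n)\<close>, half of the left-hand side \<open>r * norm (V n)\<close>, and
    is absorbed there.\<close>
  define d where "d = r / (2 * real DIM('a))"
  have d: "d > 0" "real DIM('a) * d = r / 2" using r by (auto simp: d_def)
  have "\<forall>\<^sub>F n in sequentially. dist (X n) z < d" using X d(1) by (rule tendstoD)
  then have "\<forall>\<^sub>F n in sequentially. norm (V n) \<le> 2 * real DIM('a) * m / r"
  proof eventually_elim
    case (elim n)
    have "\<bar>V n \<bullet> (X n - z)\<bar> \<le> norm (V n) * norm (X n - z)" by (rule Cauchy_Schwarz_ineq2)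
    also have "\<dots> \<le> norm (V n) * d" using elim by (intro mult_left_mono) (auto simp: dist_norm)
    finally have cs: "\<bar>V n \<bullet> (X n - z)\<bar> \<le> norm (V n) * d" .
    have "r * \<bar>V n \<bullet> b\<bar> \<le> m + norm (V n) * d" if b: "b \<in> Basis" for b
    proof -
      have "c + V n \<bullet> (z + r *\<^sub>R s - X n) \<le> m + c" if "s = b \<or> s = - b" for s
      proof -
        have "z + r *\<^sub>R s \<in> P" unfolding P_def using that b by blast
        then show ?thesis using aff[of "z + r *\<^sub>R s" n] m[of "z + r *\<^sub>R s"] P(3) by auto
      qed
      from this[of b] this[of "- b"] have "r * (V n \<bullet> b) \<le> m + V n \<bullet> (X n - z)"
        "- (r * (V n \<bullet> b)) \<le> m + V n \<bullet> (X n - z)" by (simp_all add: algebra_simps)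
      then have "\<bar>r * (V n \<bullet> b)\<bar> \<le> m + V n \<bullet> (X n - z)" by linarith
      then show ?thesis using cs r by (simp add: abs_mult)
    qed
    then have "(\<Sum>b\<in>Basis. r * \<bar>V n \<bullet> b\<bar>) \<le> real DIM('a) * (m + norm (V n) * d)"
      by (intro sum_bounded_above)
    moreover have "r * norm (V n) \<le> (\<Sum>b\<in>Basis. r * \<bar>V n \<bullet> b\<bar>)"
      using norm_le_l1[of "V n"] r by (simp flip: sum_distrib_left)
    ultimately have "r * norm (V n) \<le> real DIM('a) * m + norm (V n) * (real DIM('a) * d)"
      by (simp add: algebra_simps)
    then show ?case unfolding d(2) using r by (simp add: field_simps)
  qed
  then show ?thesis using that by blast
qed

lemma unif_convex_on_subgradient:
  fixes F :: "'a::euclidean_space \<Rightarrow> real"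
  assumes D: "open D" and lsc: "lsc_on D F" and uc: "unif_convex_on D q \<sigma> F"
    and q: "q > 0" and \<sigma>: "\<sigma> \<ge> 0" and z: "z \<in> D"
  obtains v where "\<And>y. y \<in> D \<Longrightarrow> F z + v \<bullet> (y - z) + \<sigma> / q * norm (z - y) powr q \<le> F y"
proof -
  obtain X V where X: "X \<longlonglongrightarrow> z" "\<And>n. X n \<in> D" and V: "\<And>n. V n \<in> subdifferential D F (X n)"
    using subdifferential_dense[OF D lsc z] by metis
  have sub: "F (X n) + V n \<bullet> (y - X n) + \<sigma> / q * norm (X n - y) powr q \<le> F y" if "y \<in> D" for n y
    using uc X(2) V that by (auto simp: unif_convex_on_def)
  \<comment> \<open>Supplies the constant \<open>c = F z - 1\<close>, common to all minorants, that
    \<open>bounded_slopes\<close> asks for.\<close>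
  obtain n0 where n0: "F z - 1 < F (X n)" if "n \<ge> n0" for n
    using lsc_on_sequentially[OF D lsc X(1) z, of "F z - 1"] by (auto simp: eventually_sequentially)
  have "F z - 1 + V (n + n0) \<bullet> (y - X (n + n0)) \<le> F y" if "y \<in> D" for n y
  proof -
    have "0 \<le> \<sigma> / q * norm (X (n + n0) - y) powr q" using q \<sigma> by simp
    then show ?thesis using sub[OF that, of "n + n0"] n0[of "n + n0"] by linarith
  qed
  then obtain B where "\<forall>\<^sub>F n in sequentially. norm (V (n + n0)) \<le> B"
    by (rule bounded_slopes[OF D z LIMSEQ_ignore_initial_segment[OF X(1), of n0]])
  then obtain m where m: "norm (V (n + n0)) \<le> B" if "n \<ge> m" for n
    unfolding eventually_sequentially by blast
  \<comment> \<open>\<open>m\<close> counts from index \<open>n0\<close>, so the slopes are bounded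
    from index \<open>m + n0\<close> on.\<close>
  define n1 where "n1 = m + n0"
  have n1: "norm (V (n + n1)) \<le> B" for n
    using m[of "n + m"] by (simp add: n1_def add.assoc)
  then have "bounded (range (\<lambda>n. V (n + n1)))" by (auto simp: bounded_iff)
  then obtain v s where s: "strict_mono (s :: nat \<Rightarrow> nat)" "((\<lambda>n. V (n + n1)) \<circ> s) \<longlonglongrightarrow> v"
    using bounded_imp_convergent_subsequence by blast
  define t where "t n = s n + n1" for n
  have Vt: "(\<lambda>n. V (t n)) \<longlonglongrightarrow> v" using s(2) by (simp add: t_def o_def)
  have "strict_mono t" using s(1) by (auto simp: t_def strict_mono_def)
  then have Xt: "(\<lambda>n. X (t n)) \<longlonglongrightarrow> z" using LIMSEQ_subseq_LIMSEQ[OF X(1)] by (simp add: o_def)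
  have "F z + v \<bullet> (y - z) + \<sigma> / q * norm (z - y) powr q \<le> F y" if y: "y \<in> D" for y
  proof (rule field_le_epsilon)
    fix e :: real assume "e > 0"
    then have ev: "\<forall>\<^sub>F n in sequentially. F z - e < F (X (t n))"
      using lsc_on_sequentially[OF D lsc Xt z, of "F z - e"] by simp
    \<comment> \<open>Values of \<open>F\<close> along \<open>X (t n)\<close> need not converge to
      \<open>F z\<close>; lower semicontinuity bounds them below by \<open>F z - e\<close>, which is
      the direction required, and \<open>e\<close> is arbitrary.\<close>
    have "F z - e + v \<bullet> (y - z) + \<sigma> / q * norm (z - y) powr q \<le> F y"
    proof (rule tendsto_upperbound)
      show "(\<lambda>n. F z - e + V (t n) \<bullet> (y - X (t n)) + \<sigma> / q * norm (X (t n) - y) powr q)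
        \<longlonglongrightarrow> F z - e + v \<bullet> (y - z) + \<sigma> / q * norm (z - y) powr q"
        using q by (intro tendsto_intros tendsto_powr' Vt Xt) auto
      show "\<forall>\<^sub>F n in sequentially.
          F z - e + V (t n) \<bullet> (y - X (t n)) + \<sigma> / q * norm (X (t n) - y) powr q \<le> F y"
        using ev by eventually_elim (use sub[OF y] in \<open>smt (verit)\<close>)
    qed simp
    then show "F z + v \<bullet> (y - z) + \<sigma> / q * norm (z - y) powr q \<le> F y + e" by simp
  qed
  then show ?thesis using that by blast
qed

text \<open>
  At \<open>z = x\<^sup>* + t (y - x\<^sup>*)\<close> with \<open>0 < t < 1\<close> every subgradient has nonnegative slope towards \<open>y\<close>,
  because \<open>F x\<^sup>* \<le> F z\<close>. This avoids choosing a subgradient at \<open>x\<^sup>*\<close> in the normal cone of \<open>X\<close>.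
\<close>

lemma unif_convex_on_growth:
  fixes F :: "'a::euclidean_space \<Rightarrow> real"
  assumes D: "open D" and lsc: "lsc_on D F" and uc: "unif_convex_on D q \<sigma> F"
    and q: "q > 0" and \<sigma>: "\<sigma> \<ge> 0" and X: "convex X" "X \<subseteq> D"
    and xstar: "xstar \<in> X" "\<And>y. y \<in> X \<Longrightarrow> F xstar \<le> F y" and y: "y \<in> X"
  shows "F xstar + \<sigma> / q * norm (y - xstar) powr q \<le> F y"
proof -
  have bound: "F xstar + \<sigma> / q * ((1 - t) * norm (y - xstar)) powr q \<le> F y" if t: "0 < t" "t < 1" for t
  proof -
    define z where "z = (1 - t) *\<^sub>R xstar + t *\<^sub>R y"
    have z: "z \<in> X" unfolding z_def by (intro convexD X xstar y) (use t in auto)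
    obtain v where v: "\<And>u. u \<in> D \<Longrightarrow> F z + v \<bullet> (u - z) + \<sigma> / q * norm (z - u) powr q \<le> F u"
      using unif_convex_on_subgradient[OF D lsc uc q \<sigma>] z X(2) by blast
    have pos: "0 \<le> \<sigma> / q * norm (z - xstar) powr q" using q \<sigma> by simp
    have "xstar - z = (- t) *\<^sub>R (y - xstar)" "y - z = (1 - t) *\<^sub>R (y - xstar)"
      and zy: "z - y = (t - 1) *\<^sub>R (y - xstar)" by (simp_all add: z_def algebra_simps)
    then have ip: "v \<bullet> (xstar - z) = - t * (v \<bullet> (y - xstar))" "v \<bullet> (y - z) = (1 - t) * (v \<bullet> (y - xstar))"
      by simp_all
    have "- t * (v \<bullet> (y - xstar)) \<le> 0"
      using v[of xstar] xstar X(2) z pos unfolding ip by force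
    then have "0 \<le> (1 - t) * (v \<bullet> (y - xstar))" using t by (simp add: mult_le_0_iff zero_le_mult_iff)
    moreover have "norm (z - y) = (1 - t) * norm (y - xstar)" using t by (simp add: zy)
    \<comment> \<open>Dropping the nonnegative slope term at \<open>z\<close> and using
      \<open>F xstar \<le> F z\<close> leaves the desired bound up to the factor
      \<open>1 - t\<close> in the distance.\<close>
    ultimately show ?thesis using v[of y] xstar(2)[OF z] y X(2) unfolding ip by auto
  qed
  show ?thesis
  \<comment> \<open>Letting \<open>t\<close> tend to 0 from the right restores the full distance;
    \<open>q > 0\<close> keeps \<open>powr\<close> continuous even when
    \<open>y = xstar\<close>.\<close>
  proof (rule tendsto_upperbound)
    show "((\<lambda>t. F xstar + \<sigma> / q * ((1 - t) * norm (y - xstar)) powr q)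
      \<longlongrightarrow> F xstar + \<sigma> / q * norm (y - xstar) powr q) (at_right 0)"
    proof -
      have "((\<lambda>t. F xstar + \<sigma> / q * ((1 - t) * norm (y - xstar)) powr q)
        \<longlongrightarrow> F xstar + \<sigma> / q * ((1 - 0) * norm (y - xstar)) powr q) (at_right 0)"
        using q by (intro tendsto_intros tendsto_powr')
          (auto simp: eventually_at_right_field intro!: exI[of _ 1])
      then show ?thesis by simp
    qed
    show "\<forall>\<^sub>F t in at_right 0. F xstar + \<sigma> / q * ((1 - t) * norm (y - xstar)) powr q \<le> F y"
      unfolding eventually_at_right_field using bound by (intro exI[of _ 1]) auto
  qed simp
qed

section \<open>Taylor bound for the error function\<close>

lemma hderiv_has_derivative:
  assumes "cont_diff p \<psi>" "length us < p"
  shows "(hderiv \<psi> us has_derivative (\<lambda>u. hderiv \<psi> (u # us) x)) (at x)"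
  using assms by (simp add: cont_diff_def flip: frechet_derivative_works)

text \<open>The head slot is linear because a Frechet derivative is. For a deeper slot, the
  linearity identity holds as an identity of functions of \<open>x\<close> by induction, and
  differentiating both sides carries it through one more derivative.\<close>

lemma hderiv_linear:
  assumes \<psi>: "cont_diff p \<psi>" and "length us + length ws < p"
  shows "linear (\<lambda>u. hderiv \<psi> (us @ u # ws) x)"
  using assms(2)
proof (induction us arbitrary: x)
  case Nil
  then have "hderiv \<psi> ws differentiable (at x)" using \<psi> by (simp add: cont_diff_def)
  then show ?case by (simp add: linear_frechet_derivative)
next
  case (Cons a us)
  then have lin: "linear (\<lambda>u. hderiv \<psi> (us @ u # ws) x)" for x by simp
  have diff: "(hderiv \<psi> (us @ u # ws) has_derivative (\<lambda>a. hderiv \<psi> (a # us @ u # ws) x)) (at x)" for u x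
    by (rule hderiv_has_derivative[OF \<psi>]) (use Cons.prems in simp)
  show ?case
  proof (rule linearI)
    fix u v
    have "hderiv \<psi> (us @ (u + v) # ws) = (\<lambda>x. hderiv \<psi> (us @ u # ws) x + hderiv \<psi> (us @ v # ws) x)"
      by (rule ext) (rule linear_add[OF lin])
    then show "hderiv \<psi> ((a # us) @ (u + v) # ws) x
      = hderiv \<psi> ((a # us) @ u # ws) x + hderiv \<psi> ((a # us) @ v # ws) x"
      using fun_cong[OF frechet_derivative_at[OF has_derivative_add[OF diff[of u x] diff[of v x]]], of a, symmetric]
      by simp
  next
    fix c u
    have "hderiv \<psi> (us @ (c *\<^sub>R u) # ws) = (\<lambda>x. c *\<^sub>R hderiv \<psi> (us @ u # ws) x)"
      by (rule ext) (rule linear_scale[OF lin])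
    then show "hderiv \<psi> ((a # us) @ (c *\<^sub>R u) # ws) x = c *\<^sub>R hderiv \<psi> ((a # us) @ u # ws) x"
      using fun_cong[OF frechet_derivative_at[OF has_derivative_scaleR_right[OF diff[of u x], of c]], of a, symmetric]
      by simp
  qed
qed

text \<open>Ensures that the supremum in \<open>form_norm\<close> is over a bounded set. The last
  vector of \<open>us\<close> is expanded in \<open>Basis\<close> with coefficients of modulus at
  most 1, and each basis vector moves into the fixed tail \<open>ws\<close>, where the induction
  hypothesis applies.\<close>

lemma hderiv_bounded:
  fixes \<psi> :: "'a::euclidean_space \<Rightarrow> real"
  assumes \<psi>: "cont_diff p \<psi>" and "j + length ws \<le> p"
  shows "\<exists>c. \<forall>us. length us = j \<and> (\<forall>u\<in>set us. norm u \<le> 1) \<longrightarrow> \<bar>hderiv \<psi> (us @ ws) x\<bar> \<le> c"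
  using assms(2)
proof (induction j arbitrary: ws)
  case (Suc j)
  define P where "P b c \<longleftrightarrow>
    (\<forall>us. length us = j \<and> (\<forall>u\<in>set us. norm u \<le> 1) \<longrightarrow> \<bar>hderiv \<psi> (us @ b # ws) x\<bar> \<le> c)" for b c
  have "\<exists>c. P b c" for b
    unfolding P_def by (rule Suc.IH) (use Suc.prems in simp)
  then obtain c where "\<And>b. P b (c b)" by metis
  then have c: "\<bar>hderiv \<psi> (us @ b # ws) x\<bar> \<le> c b"
    if "length us = j" "\<forall>u\<in>set us. norm u \<le> 1" for us b
    using that unfolding P_def by blast
  have "\<bar>hderiv \<psi> (us @ ws) x\<bar> \<le> (\<Sum>b\<in>Basis. c b)"
    if us': "length us = Suc j" "\<forall>u\<in>set us. norm u \<le> 1" for us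
  proof -
    obtain vs u where us: "us = vs @ [u]" by (cases us rule: rev_cases) (use us' in auto)
    have vs: "length vs = j" "\<forall>v\<in>set vs. norm v \<le> 1" and u: "norm u \<le> 1" using us' us by auto
    have lin: "linear (\<lambda>u. hderiv \<psi> (vs @ u # ws) x)"
      by (rule hderiv_linear[OF \<psi>]) (use Suc.prems vs in simp)
    have "hderiv \<psi> (us @ ws) x = hderiv \<psi> (vs @ (\<Sum>b\<in>Basis. (u \<bullet> b) *\<^sub>R b) # ws) x"
      by (simp add: us euclidean_representation)
    also have "\<dots> = (\<Sum>b\<in>Basis. (u \<bullet> b) * hderiv \<psi> (vs @ b # ws) x)"
      using linear_sum[OF lin, of "\<lambda>b. (u \<bullet> b) *\<^sub>R b" Basis] linear_scale[OF lin] by simp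
    also have "\<bar>\<dots>\<bar> \<le> (\<Sum>b\<in>Basis. \<bar>(u \<bullet> b) * hderiv \<psi> (vs @ b # ws) x\<bar>)" by (rule sum_abs)
    also have "\<dots> \<le> (\<Sum>b\<in>Basis. c b)"
    proof (rule sum_mono)
      fix b :: 'a assume b: "b \<in> Basis"
      have "\<bar>u \<bullet> b\<bar> \<le> 1" using Basis_le_norm[OF b, of u] u by simp
      then have "\<bar>u \<bullet> b\<bar> * \<bar>hderiv \<psi> (vs @ b # ws) x\<bar> \<le> 1 * c b"
        by (intro mult_mono c vs) auto
      then show "\<bar>(u \<bullet> b) * hderiv \<psi> (vs @ b # ws) x\<bar> \<le> c b" by (simp add: abs_mult)
    qed
    finally show ?thesis .
  qed
  then show ?case by blast
qed auto

lemma hderiv_replicate_scaleR: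
  assumes \<psi>: "cont_diff p \<psi>" and "j \<le> p"
  shows "hderiv \<psi> (replicate j (c *\<^sub>R u)) x = c ^ j * hderiv \<psi> (replicate j u) x"
  using assms(2)
proof (induction j arbitrary: x)
  case (Suc j)
  then have IH: "hderiv \<psi> (replicate j (c *\<^sub>R u)) = (\<lambda>x. c ^ j * hderiv \<psi> (replicate j u) x)"
    by (intro ext) simp
  have diff: "(hderiv \<psi> (replicate j v) has_derivative (\<lambda>a. hderiv \<psi> (a # replicate j v) x)) (at x)" for v
    by (rule hderiv_has_derivative[OF \<psi>]) (use Suc.prems in simp)
  have "hderiv \<psi> (replicate (Suc j) (c *\<^sub>R u)) x = c * hderiv \<psi> (u # replicate j (c *\<^sub>R u)) x"
    using linear_scale[OF has_derivative_linear[OF diff[of "c *\<^sub>R u"]], of c u] by simp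
  also have "hderiv \<psi> (u # replicate j (c *\<^sub>R u)) x = c ^ j * hderiv \<psi> (u # replicate j u) x"
    using fun_cong[OF has_derivative_unique[OF diff[of "c *\<^sub>R u", unfolded IH] has_derivative_mult_right[OF diff[of u], of "c ^ j"]], of u]
    by (simp add: IH)
  finally show ?case by simp
qed simp

lemma form_norm_bound:
  fixes \<psi> :: "'a::euclidean_space \<Rightarrow> real" and x y :: 'a
  assumes \<psi>: "cont_diff p \<psi>"
  defines "A \<equiv> (\<lambda>us. hderiv \<psi> us x - hderiv \<psi> us y)"
  shows "\<bar>A (replicate p d)\<bar> \<le> norm d ^ p * form_norm p A"
proof -
  obtain c1 c2 where
    c: "\<bar>hderiv \<psi> us x\<bar> \<le> c1" "\<bar>hderiv \<psi> us y\<bar> \<le> c2" if "length us = p" "\<forall>u\<in>set us. norm u \<le> 1" for us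
    using hderiv_bounded[OF \<psi>, of p "[]" x] hderiv_bounded[OF \<psi>, of p "[]" y] by (metis add_0_right append_Nil2 list.size(3) order_refl)
  have bdd: "bdd_above ((\<lambda>u. \<bar>A (replicate p u)\<bar>) ` cball 0 1)"
  proof (rule bdd_aboveI2)
    fix u :: 'a assume "u \<in> cball 0 1"
    then show "\<bar>A (replicate p u)\<bar> \<le> c1 + c2"
      using c[of "replicate p u"] by (auto simp: A_def)
  qed
  \<comment> \<open>For \<open>d = 0\<close> the inverse of the norm is 0, so \<open>u = 0\<close>,
    and both claims about \<open>u\<close> still hold.\<close>
  define u where "u = d /\<^sub>R norm d"
  have u: "d = norm d *\<^sub>R u" "u \<in> cball 0 1" by (cases "d = 0"; simp add: u_def)+
  have "A (replicate p d) = norm d ^ p * A (replicate p u)"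
    unfolding A_def using hderiv_replicate_scaleR[OF \<psi> order_refl, of "norm d" u] u(1)
    by (simp add: algebra_simps)
  then have "\<bar>A (replicate p d)\<bar> = norm d ^ p * \<bar>A (replicate p u)\<bar>" by (simp add: abs_mult)
  also have "\<dots> \<le> norm d ^ p * form_norm p A"
    unfolding form_norm_def by (intro mult_left_mono cSUP_upper u bdd) auto
  finally show ?thesis .
qed

lemma lipschitz_deriv_bound:
  fixes \<psi> :: "'a::euclidean_space \<Rightarrow> real"
  assumes "lipschitz_deriv p L \<psi>"
  shows "\<bar>hderiv \<psi> (replicate p d) x - hderiv \<psi> (replicate p d) y\<bar> \<le> norm d ^ p * (L * norm (x - y))"
proof -
  have "\<bar>hderiv \<psi> (replicate p d) x - hderiv \<psi> (replicate p d) y\<bar>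
      \<le> norm d ^ p * form_norm p (\<lambda>us. hderiv \<psi> us x - hderiv \<psi> us y)"
    by (rule form_norm_bound) (use assms in \<open>simp add: lipschitz_deriv_def\<close>)
  also have "\<dots> \<le> norm d ^ p * (L * norm (x - y))"
    by (intro mult_left_mono) (use assms in \<open>auto simp: lipschitz_deriv_def\<close>)
  finally show ?thesis .
qed

text \<open>Between two points at distance 1, in a unit direction, the Lipschitz bound is just
  \<open>L\<close> and dominates an absolute value. The sign makes multiplication by
  \<open>L\<close> monotone later.\<close>

lemma lipschitz_deriv_nonneg:
  fixes \<psi> :: "'a::euclidean_space \<Rightarrow> real"
  assumes "lipschitz_deriv p L \<psi>"
  shows "0 \<le> L"
proof -
  obtain b :: 'a where "b \<in> Basis" using nonempty_Basis by blast
  then show ?thesis using order_trans[OF abs_ge_zero lipschitz_deriv_bound[OF assms, of b b 0]] by simp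
qed

text \<open>Integrates the one-sided bound on \<open>\<phi> p\<close> down to
  \<open>\<phi> 0\<close>. After \<open>m\<close> integrations \<open>\<phi> (p - m)\<close> is
  controlled; at the next one, the difference \<open>?G\<close> between the bound and the function
  vanishes at 0 and has nonnegative derivative.\<close>

lemma taylor_upper_bound:
  fixes \<phi> :: "nat \<Rightarrow> real \<Rightarrow> real"
  assumes deriv: "\<And>j t. j < p \<Longrightarrow> (\<phi> j has_real_derivative \<phi> (Suc j) t) (at t)"
    and zero: "\<And>j. j < p \<Longrightarrow> \<phi> j 0 = 0"
    and bound: "\<And>t. 0 \<le> t \<Longrightarrow> \<phi> p t \<le> K * t"
    and t: "0 \<le> t"
  shows "\<phi> 0 t \<le> K * t ^ (p + 1) / fact (p + 1)"
proof -
  have "\<phi> (p - m) t \<le> K * t ^ (m + 1) / fact (m + 1)" if "m \<le> p" "0 \<le> t" for m t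
    using that
  proof (induction m arbitrary: t)
    case (Suc m)
    define j where "j = p - Suc m"
    have j: "j < p" "Suc j = p - m" using Suc.prems by (auto simp: j_def)
    let ?G = "\<lambda>t. K * t ^ (Suc m + 1) / fact (Suc m + 1) - \<phi> j t"
    have D: "(?G has_real_derivative K * s ^ (m + 1) / fact (m + 1) - \<phi> (p - m) s) (at s)" for s
    proof -
      have "(?G has_real_derivative
          K * (real (Suc m + 1) * s ^ (m + 1)) / fact (Suc m + 1) - \<phi> (Suc j) s) (at s)"
        by (rule derivative_eq_intros deriv[OF j(1)] refl | simp)+
      moreover have "K * (real (Suc m + 1) * s ^ (m + 1)) / fact (Suc m + 1) = K * s ^ (m + 1) / fact (m + 1)"
        by (simp add: fact_reduce[of "Suc (Suc m)"] del: fact_Suc)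
      ultimately show ?thesis using j by simp
    qed
    have "?G 0 \<le> ?G t"
    proof (rule DERIV_nonneg_imp_nondecreasing[where f="?G"])
      fix s assume "0 \<le> s" "s \<le> t"
      then have "\<phi> (p - m) s \<le> K * s ^ (m + 1) / fact (m + 1)" using Suc.prems Suc.IH by simp
      then show "\<exists>y. (?G has_real_derivative y) (at s) \<and> 0 \<le> y" 
        by (intro exI[of _ "K * s ^ (m + 1) / fact (m + 1) - \<phi> (p - m) s"] conjI D) simp
    qed (use Suc.prems in simp)
    then show ?case using zero[OF j(1)] by (simp add: j_def)
  qed (use bound in simp)
  from this[of p t] t show ?thesis by simp
qed

text \<open>Restricting \<open>h\<close> to the line through \<open>x\<close> and \<open>y\<close>
  reduces the claim to one variable. As the derivative of order \<open>p\<close> vanishes at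
  \<open>x\<close>, its Lipschitz bound gives \<open>\<phi> p t \<le> K * t\<close> with
  \<open>K = L * norm d ^ (p + 1)\<close>.\<close>

lemma lipschitz_deriv_taylor:
  fixes h :: "'a::euclidean_space \<Rightarrow> real"
  assumes h: "lipschitz_deriv p L h" and zero: "\<And>us. length us \<le> p \<Longrightarrow> hderiv h us x = 0"
  shows "h y \<le> L / fact (p + 1) * norm (y - x) ^ (p + 1)"
proof -
  define d where "d = y - x"
  define \<phi> where "\<phi> j t = hderiv h (replicate j d) (x + t *\<^sub>R d)" for j t
  have cd: "cont_diff p h" using h by (simp add: lipschitz_deriv_def)
  have "\<phi> 0 1 \<le> (L * norm d ^ (p + 1)) * 1 ^ (p + 1) / fact (p + 1)"
  proof (rule taylor_upper_bound)
    fix j t assume j: "j < p"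
    have *: "(hderiv h (replicate j d) has_derivative (\<lambda>a. hderiv h (a # replicate j d) (x + t *\<^sub>R d))) (at (x + t *\<^sub>R d))"
      by (rule hderiv_has_derivative[OF cd]) (use j in simp)
    have "((\<lambda>t. x + t *\<^sub>R d) has_derivative (\<lambda>s. s *\<^sub>R d)) (at t)"
      by (auto intro!: derivative_eq_intros)
    from has_derivative_compose[OF this *]
    have "((\<lambda>t. hderiv h (replicate j d) (x + t *\<^sub>R d)) has_derivative
        (\<lambda>s. hderiv h ((s *\<^sub>R d) # replicate j d) (x + t *\<^sub>R d))) (at t)" .
    moreover have "(\<lambda>s. hderiv h ((s *\<^sub>R d) # replicate j d) (x + t *\<^sub>R d)) = (\<lambda>s. \<phi> (Suc j) t * s)"
      using linear_scale[OF has_derivative_linear[OF *]] by (auto simp: \<phi>_def mult.commute)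
    ultimately show "(\<phi> j has_real_derivative \<phi> (Suc j) t) (at t)"
      unfolding has_field_derivative_def \<phi>_def by simp
  next
    fix t :: real assume "0 \<le> t"
    then show "\<phi> p t \<le> L * norm d ^ (p + 1) * t"
      using lipschitz_deriv_bound[OF h, of d "x + t *\<^sub>R d" x] zero[of "replicate p d"]
      by (simp add: \<phi>_def algebra_simps)
  qed (use zero in \<open>auto simp: \<phi>_def\<close>)
  then show ?thesis by (simp add: \<phi>_def d_def)
qed

section \<open>The deterministic recursion\<close>

lemma avg_mono:
  assumes "\<And>i. i \<in> {1..N} \<Longrightarrow> a i \<le> b i"
  shows "avg N a \<le> avg N b"
  unfolding avg_def using assms by (intro divide_right_mono sum_mono) auto

lemma avg_const: "N > 0 \<Longrightarrow> avg N (\<lambda>_. c) = c"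
  by (simp add: avg_def)

lemma avg_add: "avg N (\<lambda>i. a i + b i) = avg N a + avg N b"
  by (simp add: avg_def sum.distrib add_divide_distrib)

lemma avg_mult_left: "avg N (\<lambda>i. c * a i) = c * avg N a"
  by (simp add: avg_def sum_distrib_left)

lemma avg_nonneg:
  assumes "\<And>i. i \<in> {1..N} \<Longrightarrow> 0 \<le> a i"
  shows "0 \<le> avg N a"
  unfolding avg_def using assms by (intro divide_nonneg_nonneg sum_nonneg) auto

lemma surrogate_nonneg:
  assumes "surrogate X N p L f g" "N > 0" "x \<in> X"
  shows "0 \<le> L"
  using assms lipschitz_deriv_nonneg[of p L] by (fastforce simp: surrogate_def)

lemma surrogate_upper_bound:
  assumes "surrogate X N p L f g" "i \<in> {1..N}" "x \<in> X" "y \<in> X"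
  shows "g i y x \<le> f i y + L / fact (p + 1) * norm (y - x) ^ (p + 1)"
proof -
  obtain h where "\<forall>y\<in>X. h y = g i y x - f i y" "lipschitz_deriv p L h"
    "\<forall>us. length us \<le> p \<longrightarrow> hderiv h us x = 0"
    using assms(1-3) unfolding surrogate_def by blast
  then show ?thesis using lipschitz_deriv_taylor[of p L h x y] assms(4) by fastforce
qed

lemma SHOM_run_in:
  assumes "SHOM_run X N g x0 S x" "x0 \<in> X"
  shows "x k \<in> X"
  using assms by (cases k) (auto simp: SHOM_run_def is_arg_min_def)

lemma anchor_in:
  assumes "\<And>k. x k \<in> X"
  shows "anchor S x k j \<in> X"
  using assms by (induction k) auto

text \<open>Raising the growth inequality to the power \<open>(p + 1) / q\<close> converts
  \<open>q\<close>-th powers of distances into the powers \<open>p + 1\<close> of the Taylor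
  bound.\<close>

lemma growth_power:
  fixes x y :: "'a::real_normed_vector"
  assumes growth: "c + \<sigma> / q * norm (x - y) powr q \<le> d" and q: "q > 0" and \<sigma>: "\<sigma> > 0"
  shows "norm (x - y) ^ (p + 1) \<le> (q / \<sigma>) powr ((real p + 1) / q) * (d - c) powr ((real p + 1) / q)"
proof -
  have "norm (x - y) ^ (p + 1) = norm (x - y) powr real (p + 1)"
    by (rule powr_realpow'[symmetric]) auto
  also have "\<dots> = (norm (x - y) powr q) powr ((real p + 1) / q)"
    using q by (simp add: powr_powr add.commute)
  also have "\<dots> \<le> (q / \<sigma> * (d - c)) powr ((real p + 1) / q)"
  proof (rule powr_mono2)
    show "norm (x - y) powr q \<le> q / \<sigma> * (d - c)" using growth q \<sigma> by (simp add: field_simps)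
  qed (use q in auto)
  also have "\<dots> = (q / \<sigma>) powr ((real p + 1) / q) * (d - c) powr ((real p + 1) / q)"
    by (rule powr_mult)
  finally show ?thesis .
qed

lemma SHOM_run_step:
  fixes f :: "nat \<Rightarrow> 'a::euclidean_space \<Rightarrow> real" and N :: nat
  defines "F \<equiv> (\<lambda>y. avg N (\<lambda>i. f i y))"
  assumes run: "SHOM_run X N g x0 S x" and sur: "surrogate X N p L f g"
    and N: "N > 0" and x0: "x0 \<in> X" and xstar: "xstar \<in> X" and q: "q > 0" and \<sigma>: "\<sigma> > 0"
    and growth: "\<And>y. y \<in> X \<Longrightarrow> F xstar + \<sigma> / q * norm (y - xstar) powr q \<le> F y"
  shows "F (x (Suc k)) - F xstar
    \<le> L / fact (p + 1) * (q / \<sigma>) powr ((real p + 1) / q) * Lyap N p q F xstar S x k"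
proof -
  let ?z = "anchor S x k" and ?r = "(real p + 1) / q"
  have x: "x k \<in> X" for k by (rule SHOM_run_in[OF run x0])
  have z: "?z j \<in> X" for j by (rule anchor_in) (rule x)
  have L: "0 \<le> L" by (rule surrogate_nonneg[OF sur N x0])
  have "F (x (Suc k)) \<le> avg N (\<lambda>i. g i (x (Suc k)) (?z i))"
    unfolding F_def using sur x z by (intro avg_mono) (auto simp: surrogate_def)
  \<comment> \<open>\<open>xstar\<close> is a competitor in the surrogate problem solved by
    \<open>x (Suc k)\<close>.\<close>
  also have "\<dots> \<le> avg N (\<lambda>i. g i xstar (?z i))"
    using run xstar by (auto simp: SHOM_run_def is_arg_min_def not_less)
  also have "\<dots> \<le> avg N (\<lambda>i. f i xstar + L / fact (p + 1) * norm (?z i - xstar) ^ (p + 1))"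
    using surrogate_upper_bound[OF sur _ z xstar] by (intro avg_mono) (simp add: norm_minus_commute)
  also have "\<dots> \<le> avg N (\<lambda>i. f i xstar
      + L / fact (p + 1) * ((q / \<sigma>) powr ?r * (F (?z i) - F xstar) powr ?r))"
    using L by (intro avg_mono add_left_mono mult_left_mono growth_power[OF growth[OF z] q \<sigma>]) auto
  also have "\<dots> = F xstar + L / fact (p + 1) * (q / \<sigma>) powr ?r * Lyap N p q F xstar S x k"
    unfolding avg_add avg_mult_left Lyap_def F_def by (simp add: mult.assoc)
  finally show ?thesis by simp
qed

lemma Lyap_nonneg: "0 \<le> Lyap N p q F xstar S x k"
  unfolding Lyap_def by (intro avg_nonneg) simp

lemma Lyap_le:
  assumes "\<And>j. F xstar \<le> F (anchor S x k j)" "\<And>j. F (anchor S x k j) - F xstar \<le> B"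
    and "N > 0" "q > 0"
  shows "Lyap N p q F xstar S x k \<le> B powr ((real p + 1) / q)"
proof -
  have "Lyap N p q F xstar S x k \<le> avg N (\<lambda>_. B powr ((real p + 1) / q))"
    unfolding Lyap_def using assms by (intro avg_mono powr_mono2) auto
  then show ?thesis using assms(3) by (simp add: avg_const)
qed

text \<open>Provides integrability: the bound depends on \<open>k\<close> but is uniform over all
  runs, hence over all outcomes. If \<open>B\<close> bounds the gaps at stage \<open>k\<close>, the
  new iterate has gap at most \<open>C * B powr ((real p + 1) / q)\<close>.\<close>

lemma anchor_gap_bounded:
  assumes step: "\<And>S x k. SHOM_run X N g x0 S x \<Longrightarrow>
      F (x (Suc k)) - F xstar \<le> C * Lyap N p q F xstar S x k"
    and min: "\<And>y. y \<in> X \<Longrightarrow> F xstar \<le> F y" and x0: "x0 \<in> X"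
    and "N > 0" "q > 0" and C: "C \<ge> 0"
  shows "\<exists>B. \<forall>S x. SHOM_run X N g x0 S x \<longrightarrow> (\<forall>j. F (anchor S x k j) - F xstar \<le> B)"
proof (induction k)
  case 0
  show ?case by (auto simp: SHOM_run_def)
next
  case (Suc k)
  then obtain B where B: "F (anchor S x k j) - F xstar \<le> B" if "SHOM_run X N g x0 S x" for S x j by blast
  have "F (anchor S x (Suc k) j) - F xstar \<le> max B (C * B powr ((real p + 1) / q))"
    if run: "SHOM_run X N g x0 S x" for S x j
  proof -
    have "Lyap N p q F xstar S x k \<le> B powr ((real p + 1) / q)"
      using anchor_in[OF SHOM_run_in[OF run x0]] by (intro Lyap_le B run min assms)
    then have "F (x (Suc k)) - F xstar \<le> C * B powr ((real p + 1) / q)"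
      using step[OF run, of k] mult_left_mono[OF _ C] by (meson order_trans)
    then show ?thesis using B[OF run, of j] by auto
  qed
  then show ?case by blast
qed

text \<open>By \<open>inv\<close>, the map bounding the new gap in terms of the old ones sends the
  initial gap to at most itself, so the initial level is never exceeded.\<close>

lemma anchor_gap_le_initial:
  assumes run: "SHOM_run X N g x0 S x"
    and step: "\<And>k. F (x (Suc k)) - F xstar \<le> C * Lyap N p q F xstar S x k"
    and min: "\<And>y. y \<in> X \<Longrightarrow> F xstar \<le> F y" and x0: "x0 \<in> X"
    and "N > 0" "q > 0" and C: "C \<ge> 0"
    and inv: "C * (F x0 - F xstar) powr ((real p + 1) / q) \<le> F x0 - F xstar"
  shows "F (anchor S x k j) - F xstar \<le> F x0 - F xstar"
proof (induction k arbitrary: j)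
  case 0
  show ?case using run by (simp add: SHOM_run_def)
next
  case (Suc k)
  have "Lyap N p q F xstar S x k \<le> (F x0 - F xstar) powr ((real p + 1) / q)"
    using anchor_in[OF SHOM_run_in[OF run x0]] by (intro Lyap_le Suc.IH min assms)
  then have "F (x (Suc k)) - F xstar \<le> F x0 - F xstar"
    using step[of k] mult_left_mono[OF _ C] inv by (meson order_trans)
  then show ?case using Suc.IH by auto
qed

text \<open>The threshold raised to the power \<open>r - 1\<close> is
  \<open>\<alpha> powr (1 / r) / C\<close>. The case \<open>C = 0\<close> is separate because the
  quotient would then be 0.\<close>

lemma initial_radius:
  fixes C \<Delta> r \<alpha> :: real
  assumes C: "0 \<le> C" and \<Delta>: "0 \<le> \<Delta>" and r: "1 < r" and \<alpha>: "0 < \<alpha>"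
    and le: "C = 0 \<or> \<Delta> \<le> \<alpha> powr (1 / (r * (r - 1))) / C powr (1 / (r - 1))"
  shows "C * \<Delta> powr (r - 1) \<le> \<alpha> powr (1 / r)"
proof (cases "C = 0")
  case False
  have "\<Delta> powr (r - 1) \<le> (\<alpha> powr (1 / (r * (r - 1))) / C powr (1 / (r - 1))) powr (r - 1)"
    using r \<Delta> le False by (intro powr_mono2) auto
  also have "\<dots> = \<alpha> powr (1 / r) / C"
    using r C False \<alpha> by (subst powr_divide) (auto simp: powr_powr)
  finally show ?thesis using C False by (simp add: field_simps)
qed (use \<alpha> in simp)

section \<open>Conditional expectation of a resampled average\<close>

text \<open>A constant is measurable for \<open>H\<close>, and independence says that it has the
  same integral as the indicator over every set of \<open>H\<close>; this characterizes conditional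
  expectation.\<close>

lemma (in prob_space) real_cond_exp_indicator_indep:
  assumes sub: "subalgebra M H" and E: "E \<in> events"
    and indep: "\<And>A. A \<in> sets H \<Longrightarrow> prob (A \<inter> E) = prob A * prob E"
  shows "AE \<omega> in M. real_cond_exp M H (indicator E) \<omega> = prob E"
proof -
  interpret finite_measure_subalgebra M H by unfold_locales (rule sub)
  show ?thesis
  proof (rule real_cond_exp_charact)
    fix A assume A: "A \<in> sets H"
    then have [measurable]: "A \<in> events" using sub by (auto simp: subalgebra_def)
    have "(\<integral>\<omega>\<in>A. indicator E \<omega> \<partial>M) = (\<integral>\<omega>. indicator (A \<inter> E) \<omega> \<partial>M)"
      unfolding set_lebesgue_integral_def by (intro Bochner_Integration.integral_cong) (auto simp: indicator_def)
    also have "\<dots> = prob A * prob E" using indep[OF A] E by simp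
    also have "\<dots> = (\<integral>\<omega>\<in>A. prob E \<partial>M)"
      unfolding set_lebesgue_integral_def by simp
    finally show "(\<integral>\<omega>\<in>A. indicator E \<omega> \<partial>M) = (\<integral>\<omega>\<in>A. prob E \<partial>M)" .
  qed (use E in \<open>auto simp: integrable_indicator_iff emeasure_eq_measure\<close>)
qed

text \<open>The events of one minibatch may be correlated, so the average is split by linearity.
  Each summand is \<open>b j / N\<close> plus the indicator of \<open>E j\<close> times a
  coefficient \<open>c j\<close> known to \<open>H\<close>, which is pulled out while the indicator
  averages to \<open>\<theta>\<close>.\<close>

lemma (in prob_space) real_cond_exp_resample:
  fixes b :: "nat \<Rightarrow> 'a \<Rightarrow> real"
  assumes sub: "subalgebra M H" and E: "\<And>j. E j \<in> events"
    and indep: "\<And>A j. A \<in> sets H \<Longrightarrow> prob (A \<inter> E j) = prob A * prob (E j)"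
    and prob: "\<And>j. j \<in> {1..N} \<Longrightarrow> prob (E j) = \<theta>"
    and a: "a \<in> borel_measurable H" and b: "\<And>j. b j \<in> borel_measurable H"
    and bound: "\<And>\<omega>. \<omega> \<in> space M \<Longrightarrow> \<bar>a \<omega>\<bar> \<le> K" "\<And>j \<omega>. \<omega> \<in> space M \<Longrightarrow> \<bar>b j \<omega>\<bar> \<le> K"
    and N: "N > 0"
  shows "AE \<omega> in M. real_cond_exp M H (\<lambda>\<omega>. avg N (\<lambda>j. if \<omega> \<in> E j then a \<omega> else b j \<omega>)) \<omega>
    = (1 - \<theta>) * avg N (\<lambda>j. b j \<omega>) + \<theta> * a \<omega>"
proof -
  interpret finite_measure_subalgebra M H by unfold_locales (rule sub)
  note [measurable] = E a b measurable_from_subalg[OF sub a] measurable_from_subalg[OF sub b]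
  define c where "c j \<omega> = (a \<omega> - b j \<omega>) / N" for j \<omega>
  define u where "u j \<omega> = b j \<omega> / N + c j \<omega> * indicator (E j) \<omega>" for j \<omega>
  have c[measurable]: "c j \<in> borel_measurable H" for j unfolding c_def by measurable
  note [measurable] = measurable_from_subalg[OF sub c]
  have int_b: "integrable M (\<lambda>\<omega>. b j \<omega> / N)" for j
    by (intro integrable_divide_zero integrable_const_bound[where B=K]) (auto simp: bound intro!: AE_I2)
  have int_c: "integrable M (\<lambda>\<omega>. c j \<omega> * indicator (E j) \<omega>)" for j
  proof -
    have "integrable M a" "integrable M (b j)"
      by (intro integrable_const_bound[where B=K]; auto simp: bound intro!: AE_I2)+
    then have "integrable M (c j)" unfolding c_def by simp
    then show ?thesis using integrable_real_mult_indicator[OF E] by blast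
  qed
  have int_u: "integrable M (u j)" for j
    unfolding u_def by (intro Bochner_Integration.integrable_add int_b int_c)
  have cond_u: "AE \<omega> in M. real_cond_exp M H (u j) \<omega> = b j \<omega> / N + c j \<omega> * \<theta>" if j: "j \<in> {1..N}" for j
  proof -
    have "AE \<omega> in M. real_cond_exp M H (u j) \<omega> = real_cond_exp M H (\<lambda>\<omega>. b j \<omega> / N) \<omega>
        + real_cond_exp M H (\<lambda>\<omega>. c j \<omega> * indicator (E j) \<omega>) \<omega>"
      unfolding u_def by (intro real_cond_exp_add int_b int_c)
    moreover have "AE \<omega> in M. real_cond_exp M H (\<lambda>\<omega>. b j \<omega> / N) \<omega> = b j \<omega> / N"
      by (intro real_cond_exp_F_meas int_b) measurable
    moreover have "AE \<omega> in M. real_cond_exp M H (\<lambda>\<omega>. c j \<omega> * indicator (E j) \<omega>) \<omega>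
        = c j \<omega> * real_cond_exp M H (indicator (E j)) \<omega>"
      by (intro real_cond_exp_mult int_c) measurable
    moreover have "AE \<omega> in M. real_cond_exp M H (indicator (E j)) \<omega> = \<theta>"
      using real_cond_exp_indicator_indep[OF sub E indep, of j] unfolding prob[OF j] .
    ultimately show ?thesis by eventually_elim simp
  qed
  have "(\<lambda>\<omega>. avg N (\<lambda>j. if \<omega> \<in> E j then a \<omega> else b j \<omega>)) = (\<lambda>\<omega>. \<Sum>j=1..N. u j \<omega>)"
    unfolding avg_def sum_divide_distrib u_def c_def
    by (intro ext sum.cong refl) (auto simp: indicator_def diff_divide_distrib)
  moreover have "AE \<omega> in M. real_cond_exp M H (\<lambda>\<omega>. \<Sum>j=1..N. u j \<omega>) \<omega>
      = (\<Sum>j=1..N. real_cond_exp M H (u j) \<omega>)"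
    by (intro real_cond_exp_sum int_u)
  moreover have "AE \<omega> in M. \<forall>j\<in>{1..N}. real_cond_exp M H (u j) \<omega> = b j \<omega> / N + c j \<omega> * \<theta>"
    using cond_u by (intro AE_finite_allI) auto
  moreover have "(\<Sum>j=1..N. b j \<omega> / N + c j \<omega> * \<theta>) = (1 - \<theta>) * avg N (\<lambda>j. b j \<omega>) + \<theta> * a \<omega>" for \<omega>
  proof -
    have "(\<Sum>j=1..N. b j \<omega> / N + c j \<omega> * \<theta>) = (\<Sum>j=1..N. (1 - \<theta>) * (b j \<omega> / N) + \<theta> * (a \<omega> / N))"
      by (intro sum.cong refl) (simp add: c_def field_simps)
    then show ?thesis
      using N by (simp add: sum.distrib avg_def flip: sum_distrib_left sum_divide_distrib)
  qed
  ultimately show ?thesis by auto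
qed

section \<open>Minibatches and history\<close>

lemma finite_minibatches: "finite (minibatches N \<tau>)"
  by (simp add: minibatches_def)

lemma card_minibatches: "card (minibatches N \<tau>) = N choose \<tau>"
  unfolding minibatches_def by (simp add: n_subsets)

lemma card_minibatches_containing:
  assumes j: "j \<in> {1..N}" and \<tau>: "1 \<le> \<tau>"
  shows "card {T \<in> minibatches N \<tau>. j \<in> T} = (N - 1) choose (\<tau> - 1)"
proof -
  let ?A = "{T. T \<subseteq> {1..N} - {j} \<and> card T = \<tau> - 1}"
  have "bij_betw (insert j) ?A {T \<in> minibatches N \<tau>. j \<in> T}"
  proof (rule bij_betw_byWitness[where f'="\<lambda>T. T - {j}"])
    show "insert j ` ?A \<subseteq> {T \<in> minibatches N \<tau>. j \<in> T}"
    proof safe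
      fix T assume T: "T \<subseteq> {1..N} - {j}" "card T = \<tau> - 1"
      then have "finite T" "j \<notin> T" using finite_subset[OF T(1)] by auto
      then show "insert j T \<in> minibatches N \<tau>" using T j \<tau> by (auto simp: minibatches_def)
    qed
    show "(\<lambda>T. T - {j}) ` {T \<in> minibatches N \<tau>. j \<in> T} \<subseteq> ?A"
      by (auto simp: minibatches_def card_Diff_singleton)
  qed auto
  then have "card {T \<in> minibatches N \<tau>. j \<in> T} = card ?A" by (simp add: bij_betw_same_card)
  also have "\<dots> = (N - 1) choose (\<tau> - 1)" using j by (subst n_subsets) auto
  finally show ?thesis .
qed

lemma prob_minibatch_containing:
  assumes S: "S \<in> M \<rightarrow>\<^sub>M count_space (minibatches N \<tau>)"
    and unif: "distr M (count_space (minibatches N \<tau>)) S = uniform_count_measure (minibatches N \<tau>)"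
    and j: "j \<in> {1..N}" and \<tau>: "1 \<le> \<tau>" "\<tau> \<le> N"
  shows "measure M {\<omega> \<in> space M. j \<in> S \<omega>} = real \<tau> / real N"
proof -
  let ?B = "minibatches N \<tau>"
  have "{\<omega> \<in> space M. j \<in> S \<omega>} = S -` {T \<in> ?B. j \<in> T} \<inter> space M"
    using measurable_space[OF S] by auto
  then have "measure M {\<omega> \<in> space M. j \<in> S \<omega>} = measure (uniform_count_measure ?B) {T \<in> ?B. j \<in> T}"
    unfolding unif[symmetric] using S by (subst measure_distr) auto
  also have "\<dots> = real ((N - 1) choose (\<tau> - 1)) / real (N choose \<tau>)"
    using card_minibatches_containing[OF j \<tau>(1)]
    by (subst measure_uniform_count_measure[OF finite_minibatches]) (auto simp: card_minibatches)
  also have "\<dots> = real \<tau> / real N"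
  proof -
    \<comment> \<open>The absorption identity: both sides count minibatches with a marked
      element.\<close>
    have "\<tau> * (N choose \<tau>) = N * ((N - 1) choose (\<tau> - 1))"
      using \<tau> by (intro times_binomial_minus1_eq) simp
    then have "real \<tau> * real (N choose \<tau>) = real N * real ((N - 1) choose (\<tau> - 1))"
      by (metis of_nat_mult)
    then show ?thesis using \<tau> by (simp add: frac_eq_eq mult.commute)
  qed
  finally show ?thesis .
qed

lemma sets_history:
  "sets (history M S k) = sigma_sets (space M) {S i -` A \<inter> space M | i A. i \<le> k}"
  unfolding history_def by (rule sets_measure_of) auto

lemma space_history [simp]: "space (history M S k) = space M"
  unfolding history_def by (rule space_measure_of) auto

lemma history_mono:
  assumes "k \<le> l"
  shows "sets (history M S k) \<subseteq> sets (history M S l)"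
  unfolding sets_history using assms by (intro sigma_sets_mono') fastforce

lemma history_member:
  assumes "i \<le> k"
  shows "{\<omega> \<in> space M. j \<in> S i \<omega>} \<in> sets (history M S k)"
proof -
  have "{\<omega> \<in> space M. j \<in> S i \<omega>} = S i -` {T. j \<in> T} \<inter> space M" by auto
  then show ?thesis unfolding sets_history using assms by blast
qed

text \<open>Bridges two descriptions: \<open>history\<close> takes preimages of arbitrary sets,
  whereas measurability and independence concern subsets of \<open>B\<close>.\<close>

lemma vimage_count_space_eq:
  assumes "S \<in> M \<rightarrow>\<^sub>M count_space B"
  shows "S -` A \<inter> space M = S -` (A \<inter> B) \<inter> space M"
  using measurable_space[OF assms] by auto

lemma subalgebra_history:
  assumes S: "\<And>i. S i \<in> M \<rightarrow>\<^sub>M count_space B"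
  shows "subalgebra M (history M S k)"
  unfolding subalgebra_def space_history sets_history
proof (intro conjI refl sets.sigma_sets_subset subsetI)
  fix Q assume "Q \<in> {S i -` A \<inter> space M | i A. i \<le> k}"
  then obtain i A where "Q = S i -` A \<inter> space M" by blast
  also have "\<dots> = S i -` (A \<inter> B) \<inter> space M" by (rule vimage_count_space_eq[OF S])
  finally have "Q = S i -` (A \<inter> B) \<inter> space M" .
  then show "Q \<in> sets M" using measurable_sets[OF S, of "A \<inter> B" i] by simp
qed

lemma (in prob_space) history_indep:
  assumes indep: "indep_vars (\<lambda>_. count_space B) S UNIV" and A: "A \<in> sets (history M S k)"
  shows "prob (A \<inter> {\<omega> \<in> space M. j \<in> S (Suc k) \<omega>}) = prob A * prob {\<omega> \<in> space M. j \<in> S (Suc k) \<omega>}"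
proof -
  define G where "G i = {S i -` A \<inter> space M | A. A \<in> sets (count_space B)}" for i
  \<comment> \<open>Two disjoint blocks of indices, the past and the next draw. Independence of the
    single draws passes to the sigma-algebras generated by the blocks.\<close>
  define I where "I = case_bool {..k} {Suc k}"
  have S: "S i \<in> M \<rightarrow>\<^sub>M count_space B" for i using indep by (auto simp: indep_vars_def2)
  have G: "S i -` A \<inter> space M \<in> G i" for i A
    unfolding G_def using vimage_count_space_eq[OF S, of i A]
    by (intro CollectI exI[of _ "A \<inter> B"]) simp
  have "indep_sets G UNIV" using indep unfolding indep_vars_def2 G_def by blast
  then have "indep_sets G (\<Union>b\<in>UNIV. I b)" by (rule indep_sets_mono_index[rotated]) auto
  moreover have "Int_stable (G i)" for i
    unfolding G_def
  proof (rule Int_stableI, safe)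
    fix A A' assume "A \<in> sets (count_space B)" "A' \<in> sets (count_space B)"
    then show "\<exists>A''. S i -` A \<inter> space M \<inter> (S i -` A' \<inter> space M) = S i -` A'' \<inter> space M
        \<and> A'' \<in> sets (count_space B)"
      by (intro exI[of _ "A \<inter> A'"]) auto
  qed
  moreover have "disjoint_family_on I UNIV"
    by (auto simp: disjoint_family_on_def I_def split: bool.splits)
  ultimately have ind: "indep_sets (\<lambda>b. sigma_sets (space M) (\<Union>i\<in>I b. G i)) UNIV"
    by (intro indep_sets_collect_sigma)
  let ?E = "{\<omega> \<in> space M. j \<in> S (Suc k) \<omega>}"
  have "A \<in> sigma_sets (space M) (\<Union>i\<in>I True. G i)"
    using A unfolding sets_history by (rule rev_subsetD) (intro sigma_sets_mono', use G in \<open>auto simp: I_def\<close>)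
  moreover have "?E = S (Suc k) -` {T. j \<in> T} \<inter> space M" by auto
  then have "?E \<in> sigma_sets (space M) (\<Union>i\<in>I False. G i)"
    using G[of "Suc k" "{T. j \<in> T}"] by (auto simp: I_def)
  ultimately show ?thesis
    using indep_setsD[OF ind, of UNIV "case_bool A ?E"] by (simp add: UNIV_bool ac_simps split: bool.split)
qed

text \<open>The index shift matters: \<open>x (Suc k)\<close> is already determined by the history
  up to \<open>k\<close>, while the anchors at stage \<open>Suc k\<close> also depend on
  \<open>S (Suc k)\<close>.\<close>

lemma anchor_measurable:
  fixes x :: "nat \<Rightarrow> 'w \<Rightarrow> 'a::topological_space"
  assumes x: "\<And>k. x (Suc k) \<in> borel_measurable (history M S k)"
    and x0: "\<And>\<omega>. \<omega> \<in> space M \<Longrightarrow> x 0 \<omega> = x0"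
  shows "(\<lambda>\<omega>. anchor (\<lambda>n. S n \<omega>) (\<lambda>n. x n \<omega>) k j) \<in> borel_measurable (history M S k)"
proof (induction k)
  case 0
  have "(\<lambda>\<omega>. x 0 \<omega>) \<in> borel_measurable (history M S 0) \<longleftrightarrow> (\<lambda>_. x0) \<in> borel_measurable (history M S 0)"
    by (rule measurable_cong) (simp add: x0)
  then show ?case by simp
next
  case (Suc k)
  have mono: "u \<in> borel_measurable (history M S (Suc k))" if "u \<in> borel_measurable (history M S k)" for u :: "'w \<Rightarrow> 'a"
  proof (rule measurable_from_subalg[OF _ that])
    show "subalgebra (history M S (Suc k)) (history M S k)"
      unfolding subalgebra_def using history_mono[of k "Suc k" M S] by simp
  qed
  have "{\<omega> \<in> space (history M S (Suc k)). j \<in> S (Suc k) \<omega>} \<in> sets (history M S (Suc k))"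
    using history_member[of "Suc k" "Suc k" M j S] by simp
  then show ?case unfolding anchor.simps by (intro measurable_If mono x Suc)
qed

section \<open>Convergence of SHOM\<close>

text \<open>Conditional expectations are determined only almost everywhere, hence \<open>AE\<close>.
  For \<open>C = 0\<close> the threshold on the initial gap is to be read as infinite, but division
  by zero yields 0 in HOL; the disjunct \<open>C = 0\<close> restores that reading.\<close>

theorem theorem5p5:
  fixes D X :: "'a::euclidean_space set"
    and N \<tau> p :: nat
    and q \<sigma> L \<alpha> :: real
    and f :: "nat \<Rightarrow> 'a \<Rightarrow> real"
    and g :: "nat \<Rightarrow> 'a \<Rightarrow> 'a \<Rightarrow> real"
    and F :: "'a \<Rightarrow> real"
    and xstar x0 :: 'a
    and M :: "'w measure"
    and S :: "nat \<Rightarrow> 'w \<Rightarrow> nat set"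
    and x :: "nat \<Rightarrow> 'w \<Rightarrow> 'a"
    and \<Phi> :: "nat \<Rightarrow> 'w \<Rightarrow> real"
    and C :: real
  defines "F \<equiv> (\<lambda>y. avg N (\<lambda>i. f i y))"
    and "\<Phi> \<equiv> (\<lambda>k \<omega>. Lyap N p q F xstar (\<lambda>n. S n \<omega>) (\<lambda>n. x n \<omega>) k)"
    and "C \<equiv> L / fact (p + 1) * (q / \<sigma>) powr ((real p + 1) / q)"
  assumes "open D" and "closed X" and "convex X" and "X \<subseteq> D"
    and "\<And>i. i \<in> {1..N} \<Longrightarrow> lsc_on D (f i)"
    and "q \<ge> 2" and "\<sigma> > 0" and "unif_convex_on D q \<sigma> F"
    and "p \<ge> 1" and "surrogate X N p L f g"
    and "xstar \<in> X" and "\<And>y. y \<in> X \<Longrightarrow> y \<noteq> xstar \<Longrightarrow> F xstar < F y"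
    and "1 \<le> \<tau>" and "\<tau> \<le> N" and "x0 \<in> X"
    and "SHOM M X N \<tau> g x0 S x"
  shows "(\<forall>k. AE \<omega> in M.
            real_cond_exp M (history M S k) (\<Phi> (Suc k)) \<omega>
              \<le> (1 - real \<tau> / real N + real \<tau> / real N *
                    (q powr ((real p + 1) / q) * L / (\<sigma> powr ((real p + 1) / q) * fact (p + 1)))
                      powr ((real p + 1) / q)
                    * \<Phi> k \<omega> powr ((real p + 1 - q) / q)) * \<Phi> k \<omega>)
       \<and> (0 < \<alpha> \<and> \<alpha> < 1 \<and> q < real p + 1
            \<and> (C = 0 \<or> F x0 - F xstar \<le>
                 \<alpha> powr (q\<^sup>2 / ((real p + 1)\<^sup>2 - q * (real p + 1))) / C powr (q / (real p + 1 - q)))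
          \<longrightarrow> (\<forall>k. AE \<omega> in M.
                real_cond_exp M (history M S k) (\<Phi> (Suc k)) \<omega>
                  \<le> (1 - (1 - \<alpha>) * real \<tau> / real N) * \<Phi> k \<omega>))"
proof -
  let ?r = "(real p + 1) / q" and ?\<theta> = "real \<tau> / real N"
  note D = \<open>open D\<close> and X = \<open>convex X\<close> \<open>X \<subseteq> D\<close> and sur = \<open>surrogate X N p L f g\<close>
    and xstar = \<open>xstar \<in> X\<close> and x0 = \<open>x0 \<in> X\<close> and \<sigma> = \<open>\<sigma> > 0\<close>
  have q: "q > 0" using \<open>q \<ge> 2\<close> by simp
  have N: "N > 0" using \<open>1 \<le> \<tau>\<close> \<open>\<tau> \<le> N\<close> by simp
  have r: "?r > 0" and r1: "?r - 1 = (real p + 1 - q) / q" using q by (auto simp: field_simps)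
  have \<theta>: "0 \<le> ?\<theta>" by simp
  have min: "F xstar \<le> F y" if "y \<in> X" for y
    using assms(15)[OF that] by (cases "y = xstar") auto
  have lsc: "lsc_on D F"
    unfolding F_def using assms(8) N by (intro lsc_on_avg) auto
  have growth: "F xstar + \<sigma> / q * norm (y - xstar) powr q \<le> F y" if "y \<in> X" for y
    using unif_convex_on_growth[OF D lsc \<open>unif_convex_on D q \<sigma> F\<close> q _ X xstar min that] \<sigma> by simp
  have C: "0 \<le> C"
    unfolding C_def using surrogate_nonneg[OF sur N x0] by simp
  have C_eq: "q powr ?r * L / (\<sigma> powr ?r * fact (p + 1)) = C"
    unfolding C_def using q \<sigma> by (subst powr_divide) (auto simp: field_simps)
  have step: "F (y (Suc k)) - F xstar \<le> C * Lyap N p q F xstar T y k"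
    if "SHOM_run X N g x0 T y" for T y k
    unfolding C_def F_def
    by (rule SHOM_run_step[OF that sur N x0 xstar q \<sigma> growth[unfolded F_def]])

  have SHOM: "SHOM M X N \<tau> g x0 S x" by fact
  interpret prob_space M using SHOM by (simp add: SHOM_def)
  have indep: "indep_vars (\<lambda>_. count_space (minibatches N \<tau>)) S UNIV"
    and unif: "distr M (count_space (minibatches N \<tau>)) (S k) = uniform_count_measure (minibatches N \<tau>)"
    and x_meas: "x (Suc k) \<in> borel_measurable (history M S k)"
    and run: "\<omega> \<in> space M \<Longrightarrow> SHOM_run X N g x0 (\<lambda>k. S k \<omega>) (\<lambda>k. x k \<omega>)" for k \<omega>
    using SHOM by (auto simp: SHOM_def)
  have S: "S k \<in> M \<rightarrow>\<^sub>M count_space (minibatches N \<tau>)" for k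
    using indep by (simp add: indep_vars_def2)
  define z where "z k j \<omega> = anchor (\<lambda>n. S n \<omega>) (\<lambda>n. x n \<omega>) k j" for k j \<omega>
  define \<delta> where "\<delta> y = F y - F xstar" for y
  have xX: "x k \<omega> \<in> X" and zX: "z k j \<omega> \<in> X" if "\<omega> \<in> space M" for k j \<omega>
    using SHOM_run_in[OF run[OF that] x0] unfolding z_def by (auto intro: anchor_in)
  have \<delta>_nonneg: "0 \<le> \<delta> y" if "y \<in> X" for y using min[OF that] by (simp add: \<delta>_def)
  have \<Phi>_eq: "\<Phi> k \<omega> = avg N (\<lambda>j. \<delta> (z k j \<omega>) powr ?r)" for k \<omega>
    by (simp add: \<Phi>_def Lyap_def z_def \<delta>_def)
  have \<Phi>_nonneg: "0 \<le> \<Phi> k \<omega>" for k \<omega>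
    unfolding \<Phi>_def by (rule Lyap_nonneg)
  have \<delta>_step: "\<delta> (x (Suc k) \<omega>) \<le> C * \<Phi> k \<omega>" if "\<omega> \<in> space M" for k \<omega>
    unfolding \<delta>_def \<Phi>_def by (rule step[OF run[OF that]])

  \<comment> \<open>\<open>F\<close> is known to be Borel only after the cut-off outside
    \<open>D\<close>; values in \<open>X \<subseteq> D\<close> do not see the cut-off.\<close>
  have \<delta>_meas: "(\<lambda>\<omega>. \<delta> (y \<omega>) powr ?r) \<in> borel_measurable (history M S k)"
    if y: "y \<in> borel_measurable (history M S k)" "\<And>\<omega>. \<omega> \<in> space M \<Longrightarrow> y \<omega> \<in> X" for y k
  proof -
    have "(\<lambda>\<omega>. \<delta> (y \<omega>) powr ?r) \<in> borel_measurable (history M S k) \<longleftrightarrow>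
      (\<lambda>\<omega>. ((if y \<omega> \<in> D then F (y \<omega>) else 0) - F xstar) powr ?r) \<in> borel_measurable (history M S k)"
      using y(2) X(2) by (intro measurable_cong) (auto simp: \<delta>_def)
    moreover have "(\<lambda>\<omega>. if y \<omega> \<in> D then F (y \<omega>) else 0) \<in> borel_measurable (history M S k)"
      using measurable_compose[OF y(1) lsc_on_borel_measurable[OF D lsc]] by simp
    ultimately show ?thesis by simp
  qed
  have x_init: "x 0 \<omega> = x0" if "\<omega> \<in> space M" for \<omega>
    using run[OF that] by (simp add: SHOM_run_def)
  have z_meas: "z k j \<in> borel_measurable (history M S k)" for k j
    unfolding z_def by (rule anchor_measurable[OF x_meas x_init])

  \<comment> \<open>An exact identity: \<open>E j\<close> is the event that anchor \<open>j\<close>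
    is refreshed, \<open>a\<close> its new contribution and \<open>b j\<close> its old one, both
    known given the history up to \<open>k\<close>.\<close>
  have cond: "AE \<omega> in M. real_cond_exp M (history M S k) (\<Phi> (Suc k)) \<omega>
      = (1 - ?\<theta>) * \<Phi> k \<omega> + ?\<theta> * \<delta> (x (Suc k) \<omega>) powr ?r" for k
  proof -
    define E where "E j = {\<omega> \<in> space M. j \<in> S (Suc k) \<omega>}" for j
    define a where "a \<omega> = \<delta> (x (Suc k) \<omega>) powr ?r" for \<omega>
    define b where "b j \<omega> = \<delta> (z k j \<omega>) powr ?r" for j \<omega>
    have sub: "subalgebra M (history M S n)" for n by (rule subalgebra_history[OF S])
    have E: "E j \<in> events" for j
      using history_member[of "Suc k" "Suc k" M j S] sub by (auto simp: E_def subalgebra_def)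
    have a: "a \<in> borel_measurable (history M S k)"
      unfolding a_def by (intro \<delta>_meas x_meas xX)
    have b: "b j \<in> borel_measurable (history M S k)" for j
      unfolding b_def by (intro \<delta>_meas z_meas zX)
    obtain B where B: "\<delta> (z k j \<omega>) \<le> B" if "\<omega> \<in> space M" for j \<omega>
      using anchor_gap_bounded[OF step min x0 N q C, where k=k] run unfolding z_def \<delta>_def by blast
    have \<Phi>_bound: "\<Phi> k \<omega> \<le> B powr ?r" if "\<omega> \<in> space M" for \<omega>
      unfolding \<Phi>_def
      by (rule Lyap_le) (use B zX min that N q in \<open>auto simp: z_def \<delta>_def\<close>)
    define K where "K = max ((C * B powr ?r) powr ?r) (B powr ?r)"
    have aK: "\<bar>a \<omega>\<bar> \<le> K" if "\<omega> \<in> space M" for \<omega>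
    proof -
      have "\<delta> (x (Suc k) \<omega>) \<le> C * B powr ?r"
        using \<delta>_step[OF that, of k] mult_left_mono[OF \<Phi>_bound[OF that] C] by linarith
      then have "a \<omega> \<le> (C * B powr ?r) powr ?r"
        unfolding a_def using r \<delta>_nonneg[OF xX[OF that]] by (intro powr_mono2) auto
      then show ?thesis by (simp add: K_def a_def)
    qed
    have bK: "\<bar>b j \<omega>\<bar> \<le> K" if "\<omega> \<in> space M" for j \<omega>
    proof -
      have "b j \<omega> \<le> B powr ?r"
        unfolding b_def using r B[OF that] \<delta>_nonneg[OF zX[OF that]] by (intro powr_mono2) auto
      then show ?thesis by (simp add: K_def b_def)
    qed
    let ?\<Psi> = "\<lambda>\<omega>. avg N (\<lambda>j. if \<omega> \<in> E j then a \<omega> else b j \<omega>)"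
    have \<Psi>_eq: "\<Phi> (Suc k) \<omega> = ?\<Psi> \<omega>" if "\<omega> \<in> space M" for \<omega>
      unfolding \<Phi>_eq using that by (auto simp: a_def b_def z_def E_def intro!: arg_cong[where f="avg N"])
    \<comment> \<open>\<open>\<Phi> (Suc k)\<close> and \<open>?\<Psi>\<close> are shown to agree on
      \<open>space M\<close>; measurability of both then lets their conditional expectations be
      identified.\<close>
    have "?\<Psi> \<in> borel_measurable M"
      unfolding avg_def using E measurable_from_subalg[OF sub a] measurable_from_subalg[OF sub b]
      by (intro borel_measurable_divide borel_measurable_sum borel_measurable_const measurable_If_set) auto
    moreover from this have "\<Phi> (Suc k) \<in> borel_measurable M"
      using measurable_cong[of M "\<Phi> (Suc k)" ?\<Psi>] \<Psi>_eq by blast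
    ultimately have "AE \<omega> in M. real_cond_exp M (history M S k) (\<Phi> (Suc k)) \<omega>
        = real_cond_exp M (history M S k) ?\<Psi> \<omega>"
      using \<Psi>_eq finite_measure_subalgebra_is_sigma_finite[of M "history M S k"] sub
      by (intro sigma_finite_subalgebra.real_cond_exp_cong AE_I2)
        (auto simp: finite_measure_subalgebra_def finite_measure_subalgebra_axioms_def finite_measure_axioms)
    moreover have "AE \<omega> in M. real_cond_exp M (history M S k) ?\<Psi> \<omega>
        = (1 - ?\<theta>) * avg N (\<lambda>j. b j \<omega>) + ?\<theta> * a \<omega>"
    proof (rule real_cond_exp_resample[OF sub E _ _ a b aK bK N])
      show "prob (A \<inter> E j) = prob A * prob (E j)" if "A \<in> sets (history M S k)" for A j
        unfolding E_def by (rule history_indep[OF indep that])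
      show "prob (E j) = ?\<theta>" if "j \<in> {1..N}" for j
        unfolding E_def by (rule prob_minibatch_containing[OF S unif that]) fact+
    qed
    ultimately show ?thesis by eventually_elim (simp add: \<Phi>_eq a_def b_def)
  qed
  have main: "(1 - ?\<theta>) * \<Phi> k \<omega> + ?\<theta> * \<delta> (x (Suc k) \<omega>) powr ?r
      \<le> (1 - ?\<theta> + ?\<theta> * C powr ?r * \<Phi> k \<omega> powr (?r - 1)) * \<Phi> k \<omega>" if \<omega>: "\<omega> \<in> space M" for k \<omega>
  proof -
    have "\<delta> (x (Suc k) \<omega>) powr ?r \<le> (C * \<Phi> k \<omega>) powr ?r"
      using \<delta>_step[OF \<omega>] \<delta>_nonneg[OF xX[OF \<omega>]] r by (intro powr_mono2) auto
    also have "\<dots> = C powr ?r * \<Phi> k \<omega> powr ?r"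
      by (rule powr_mult)
    \<comment> \<open>At \<open>\<Phi> k \<omega> = 0\<close> both sides are 0, because
      \<open>0 powr s = 0\<close> even for a negative exponent.\<close>
    also have "\<Phi> k \<omega> powr ?r = \<Phi> k \<omega> powr (?r - 1) * \<Phi> k \<omega>"
      using \<Phi>_nonneg[of k \<omega>] by (cases "\<Phi> k \<omega> = 0") (auto simp: powr_diff)
    finally have "?\<theta> * \<delta> (x (Suc k) \<omega>) powr ?r \<le> ?\<theta> * (C powr ?r * (\<Phi> k \<omega> powr (?r - 1) * \<Phi> k \<omega>))"
      using \<theta> by (rule mult_left_mono)
    then show ?thesis by (simp only: distrib_right mult.assoc)
  qed
  have first: "AE \<omega> in M. real_cond_exp M (history M S k) (\<Phi> (Suc k)) \<omega>
      \<le> (1 - ?\<theta> + ?\<theta> * C powr ?r * \<Phi> k \<omega> powr (?r - 1)) * \<Phi> k \<omega>" for k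
    using cond[of k] AE_space by eventually_elim (use main in simp)

  have second: "AE \<omega> in M. real_cond_exp M (history M S k) (\<Phi> (Suc k)) \<omega>
      \<le> (1 - (1 - \<alpha>) * real \<tau> / real N) * \<Phi> k \<omega>"
    if \<alpha>: "0 < \<alpha>" "\<alpha> < 1" and qp: "q < real p + 1"
      and init: "C = 0 \<or> F x0 - F xstar \<le>
        \<alpha> powr (q\<^sup>2 / ((real p + 1)\<^sup>2 - q * (real p + 1))) / C powr (q / (real p + 1 - q))" for k
  proof -
    have r_gt: "1 < ?r" using qp q by simp
    \<comment> \<open>Rewrites the exponents of the threshold in terms of \<open>?r\<close>, as
      \<open>initial_radius\<close> expects them.\<close>
    have "1 / (?r * (?r - 1)) = q\<^sup>2 / ((real p + 1)\<^sup>2 - q * (real p + 1))"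
      "1 / (?r - 1) = q / (real p + 1 - q)"
      unfolding r1 using q by (simp_all add: power2_eq_square algebra_simps)
    then have init': "C = 0 \<or> \<delta> x0 \<le> \<alpha> powr (1 / (?r * (?r - 1))) / C powr (1 / (?r - 1))"
      using init by (simp only: \<delta>_def)
    have \<delta>0: "0 \<le> \<delta> x0" by (rule \<delta>_nonneg[OF x0])
    have rad: "C * \<delta> x0 powr (?r - 1) \<le> \<alpha> powr (1 / ?r)"
      by (rule initial_radius[OF C \<delta>0 r_gt \<alpha>(1) init'])
    \<comment> \<open>With \<open>\<alpha> < 1\<close> the threshold also gives
      \<open>C * \<delta> x0 powr ?r \<le> \<delta> x0\<close>, the invariance that keeps all
      anchors below the initial gap.\<close>
    also have "\<dots> \<le> 1" using \<alpha> q by (intro powr_le1) auto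
    finally have "C * \<delta> x0 powr (?r - 1) * \<delta> x0 \<le> \<delta> x0"
      using mult_right_mono[OF _ \<delta>0] by fastforce
    moreover have "\<delta> x0 powr ?r = \<delta> x0 powr (?r - 1) * \<delta> x0"
      using \<delta>0 by (cases "\<delta> x0 = 0") (auto simp: powr_diff)
    ultimately have inv: "C * \<delta> x0 powr ?r \<le> \<delta> x0" by (simp add: mult.assoc)
    have contraction: "C powr ?r * \<Phi> k \<omega> powr (?r - 1) \<le> \<alpha>" if \<omega>: "\<omega> \<in> space M" for \<omega>
    proof -
      have "\<delta> (z k j \<omega>) \<le> \<delta> x0" for j
        using anchor_gap_le_initial[OF run[OF \<omega>] step[OF run[OF \<omega>]] min x0 N q C] inv
        by (simp add: \<delta>_def z_def)
      then have "\<Phi> k \<omega> \<le> \<delta> x0 powr ?r"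
        unfolding \<Phi>_def
        by (intro Lyap_le) (use min[OF zX[OF \<omega>]] N q in \<open>auto simp: z_def \<delta>_def\<close>)
      then have "\<Phi> k \<omega> powr (?r - 1) \<le> (\<delta> x0 powr ?r) powr (?r - 1)"
        using r_gt \<Phi>_nonneg by (intro powr_mono2) auto
      then have "C powr ?r * \<Phi> k \<omega> powr (?r - 1) \<le> C powr ?r * (\<delta> x0 powr ?r) powr (?r - 1)"
        by (intro mult_left_mono) auto
      \<comment> \<open>Swapping the order of the exponents \<open>?r\<close> and
        \<open>?r - 1\<close> exposes the quantity bounded by \<open>\<alpha> powr (1 / ?r)\<close>;
        the outer power then yields exactly \<open>\<alpha>\<close>.\<close>
      also have "\<dots> = (C * \<delta> x0 powr (?r - 1)) powr ?r"
        using C by (simp add: powr_mult powr_powr mult.commute)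
      also have "\<dots> \<le> (\<alpha> powr (1 / ?r)) powr ?r"
        using rad C r by (intro powr_mono2) auto
      also have "\<dots> = \<alpha>" using \<alpha> q by (simp add: powr_powr)
      finally show ?thesis .
    qed
    show ?thesis
      using first[of k] AE_space
    proof eventually_elim
      case (elim \<omega>)
      have "?\<theta> * C powr ?r * \<Phi> k \<omega> powr (?r - 1) \<le> ?\<theta> * \<alpha>"
        using mult_left_mono[OF contraction[OF elim(2)] \<theta>] by (simp only: mult.assoc)
      moreover have "(1 - \<alpha>) * real \<tau> / real N = ?\<theta> - ?\<theta> * \<alpha>"
        using N by (simp add: field_simps)
      ultimately have "1 - ?\<theta> + ?\<theta> * C powr ?r * \<Phi> k \<omega> powr (?r - 1) \<le> 1 - (1 - \<alpha>) * real \<tau> / real N"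
        by linarith
      from mult_right_mono[OF this \<Phi>_nonneg[of k \<omega>]] show ?case using elim(1) by linarith
    qed
  qed
  show ?thesis
    unfolding C_eq r1[symmetric] using first second by blast
qed

end
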